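(* Let $q\in[-1,0)\cup(0,1]$ and let $A_q$ be the $C^*$-algebra of the quantum $4$-sphere $S^4_q$, with generators $\alpha,\beta,z$. Then the element $$e=\frac12\begin{pmatrix} 1+z & 0 & \alpha & \beta\\ 0 & 1+z & -q\beta^* & \alpha^*\\ \alpha^* & -q\beta & 1-z & 0\\ \beta^* & \alpha & 0 & 1-z\end{pmatrix}\in \mathrm{Mat}_4(A_q)$$ is a selfadjoint idempotent: $e^2=e=e^*$.
   Context: For $q\in[-1,0)\cup(0,1]$, $A_q$ is the universal unital $C^*$-algebra (unit $\mathbb I$, also written $1$) generated by three elements $\alpha,\beta,z$ subject to the relations $$\beta\alpha=q\alpha\beta,\quad \beta^*\alpha=q\alpha\beta^*,\quad \beta\beta^*=\beta^*\beta,$$ $$z=z^*,\quad z\alpha=\alpha z,\quad z\beta=\beta z,$$ $$\alpha^*\alpha+q^2\beta^*\beta+z^2=\mathbb I,\qquad \alpha\alpha^*+\beta\beta^*+z^2=\mathbb I.$$ That is, $A_q$ is the completion of the quotient of the free unital $*$-algebra on $\alpha,\beta,z$ by the null ideal of the seminorm $\|a\|=\sup_\pi\|\pi(a)\|$, the supremum being over all $*$-representations $\pi$ by bounded operators on Hilbert spaces such that $\pi(\alpha),\pi(\beta),\pi(z)$ satisfy the relations. The involution on $\mathrm{Mat}_4(A_q)$ is the conjugate transpose. *)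

theory Defs
  imports Complex_Main
    "HOL-Library.Poly_Mapping"
    "HOL-Library.Countable"
    "HOL-Library.Function_Algebras"
    "HOL-Algebra.QuotRing"
    "HOL-Algebra.Module"
    "Jordan_Normal_Form.Matrix"
begin

section \<open>The free unital *-algebra on three generators\<close>

datatype generator = Alpha | Beta | Zed

text \<open>A word is a list of letters \<open>(g, s)\<close>, where \<open>s = True\<close> marks the formal adjoint
  \<open>g\<^sup>*\<close> of the generator \<open>g\<close>. The free unital *-algebra is the monoid algebra over \<open>\<complex>\<close> of the
  free monoid of words, whose product is written additively because that is the form in which
  \<open>Poly_Mapping\<close> provides the convolution product.\<close>

datatype word = Word (letters: "(generator \<times> bool) list")

instantiation word :: monoid_add
begin
definition zero_word :: word where "0 = Word []"
definition plus_word :: "word \<Rightarrow> word \<Rightarrow> word" where "v + w = Word (letters v @ letters w)"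
instance by standard (auto simp: zero_word_def plus_word_def)
end

definition word_star :: "word \<Rightarrow> word" where
  "word_star w = Word (rev (map (\<lambda>(g, s). (g, \<not> s)) (letters w)))"

type_synonym free_alg = "word \<Rightarrow>\<^sub>0 complex"

definition free_scale :: "complex \<Rightarrow> free_alg \<Rightarrow> free_alg" where
  "free_scale c a = Poly_Mapping.map ((*) c) a"

text \<open>The coefficient of \<open>w\<close> in \<open>a\<^sup>*\<close> is the conjugate of the coefficient of \<open>w\<^sup>*\<close> in \<open>a\<close>.\<close>

definition free_star :: "free_alg \<Rightarrow> free_alg" where
  "free_star a = Poly_Mapping.map_key word_star (Poly_Mapping.map cnj a)"

definition free_gen :: "generator \<Rightarrow> free_alg" where
  "free_gen g = Poly_Mapping.single (Word [(g, False)]) 1"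

definition sphere_relations :: "real \<Rightarrow> (free_alg \<times> free_alg) set" where
  "sphere_relations q =
    (let \<alpha> = free_gen Alpha; \<beta> = free_gen Beta; z = free_gen Zed; q' = complex_of_real q in
     {(\<beta> * \<alpha>, free_scale q' (\<alpha> * \<beta>)),
      (free_star \<beta> * \<alpha>, free_scale q' (\<alpha> * free_star \<beta>)),
      (\<beta> * free_star \<beta>, free_star \<beta> * \<beta>),
      (z, free_star z),
      (z * \<alpha>, \<alpha> * z),
      (z * \<beta>, \<beta> * z),
      (free_star \<alpha> * \<alpha> + free_scale (q'^2) (free_star \<beta> * \<beta>) + z^2, 1),
      (\<alpha> * free_star \<alpha> + \<beta> * free_star \<beta> + z^2, 1)})"


section \<open>Representations by bounded operators on Hilbert spaces\<close>

definition vec_norm :: "('h \<Rightarrow> 'h \<Rightarrow> complex) \<Rightarrow> 'h \<Rightarrow> real" where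
  "vec_norm ip x = sqrt (Re (ip x x))"

text \<open>The space is a linear subspace of an ambient vector space; the inner product is defined on
  that subspace only and is linear in its second argument.\<close>

locale complex_hilbert_space = vector_space scale
  for scale :: "complex \<Rightarrow> 'h::ab_group_add \<Rightarrow> 'h" +
  fixes H :: "'h set" and ip :: "'h \<Rightarrow> 'h \<Rightarrow> complex"
  assumes subspace: "subspace H"
    and ip_add: "\<lbrakk>x \<in> H; y \<in> H; z \<in> H\<rbrakk> \<Longrightarrow> ip x (y + z) = ip x y + ip x z"
    and ip_scale: "\<lbrakk>x \<in> H; y \<in> H\<rbrakk> \<Longrightarrow> ip x (scale c y) = c * ip x y"
    and ip_commute: "\<lbrakk>x \<in> H; y \<in> H\<rbrakk> \<Longrightarrow> ip y x = cnj (ip x y)"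
    and ip_pos: "\<lbrakk>x \<in> H; x \<noteq> 0\<rbrakk> \<Longrightarrow> Re (ip x x) > 0"
    and complete: "\<lbrakk>\<And>n. s n \<in> H;
        \<And>e. e > 0 \<Longrightarrow> \<exists>N. \<forall>m\<ge>N. \<forall>n\<ge>N. vec_norm ip (s m - s n) < e\<rbrakk>
      \<Longrightarrow> \<exists>x\<in>H. (\<lambda>n. vec_norm ip (s (n::nat) - x)) \<longlonglongrightarrow> 0"

text \<open>Operators are functions on the ambient type that are only looked at on \<open>H\<close>.\<close>

definition bounded_operator ::
  "(complex \<Rightarrow> 'h \<Rightarrow> 'h) \<Rightarrow> 'h::ab_group_add set \<Rightarrow> ('h \<Rightarrow> 'h \<Rightarrow> complex) \<Rightarrow> ('h \<Rightarrow> 'h) \<Rightarrow> bool" where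
  "bounded_operator scale H ip T \<longleftrightarrow>
     (\<forall>x\<in>H. T x \<in> H) \<and>
     (\<forall>x\<in>H. \<forall>y\<in>H. T (x + y) = T x + T y) \<and>
     (\<forall>c. \<forall>x\<in>H. T (scale c x) = scale c (T x)) \<and>
     (\<exists>C. \<forall>x\<in>H. vec_norm ip (T x) \<le> C * vec_norm ip x)"

definition op_norm :: "'h set \<Rightarrow> ('h \<Rightarrow> 'h \<Rightarrow> complex) \<Rightarrow> ('h \<Rightarrow> 'h) \<Rightarrow> real" where
  "op_norm H ip T = (SUP x\<in>{x \<in> H. vec_norm ip x \<le> 1}. vec_norm ip (T x))"

definition star_representation ::
  "(complex \<Rightarrow> 'h \<Rightarrow> 'h) \<Rightarrow> 'h::ab_group_add set \<Rightarrow> ('h \<Rightarrow> 'h \<Rightarrow> complex)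
     \<Rightarrow> (free_alg \<Rightarrow> 'h \<Rightarrow> 'h) \<Rightarrow> bool" where
  "star_representation scale H ip \<pi> \<longleftrightarrow>
     (\<forall>a. bounded_operator scale H ip (\<pi> a)) \<and>
     (\<forall>a b. \<forall>x\<in>H. \<pi> (a + b) x = \<pi> a x + \<pi> b x) \<and>
     (\<forall>c a. \<forall>x\<in>H. \<pi> (free_scale c a) x = scale c (\<pi> a x)) \<and>
     (\<forall>a b. \<forall>x\<in>H. \<pi> (a * b) x = \<pi> a (\<pi> b x)) \<and>
     (\<forall>x\<in>H. \<pi> 1 x = x) \<and>
     (\<forall>a. \<forall>x\<in>H. \<forall>y\<in>H. ip x (\<pi> (free_star a) y) = ip (\<pi> a x) y)"

definition satisfies_relations ::
  "real \<Rightarrow> 'h set \<Rightarrow> (free_alg \<Rightarrow> 'h \<Rightarrow> 'h) \<Rightarrow> bool" where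
  "satisfies_relations q H \<pi> \<longleftrightarrow> (\<forall>(a, b)\<in>sphere_relations q. \<forall>x\<in>H. \<pi> a x = \<pi> b x)"

text \<open>A supremum over all Hilbert spaces cannot range over all types. The seminorm below ranges over
  all Hilbert spaces whose underlying vector space is a linear subspace of \<open>\<complex>\<^bsup>\<nat>\<^esup>\<close>, carrying an
  arbitrary inner product. Lemma \<open>op_norm_le_sphere_seminorm\<close> shows that every representation on a
  Hilbert space over any type is dominated by it, so nothing is lost.\<close>

definition seq_scale :: "complex \<Rightarrow> (nat \<Rightarrow> complex) \<Rightarrow> nat \<Rightarrow> complex" where
  "seq_scale c f = (\<lambda>n. c * f n)"

definition sphere_seminorm :: "real \<Rightarrow> free_alg \<Rightarrow> real" where
  "sphere_seminorm q a =
     Sup {op_norm H ip (\<pi> a) | H ip \<pi>.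
            complex_hilbert_space seq_scale H ip \<and>
            star_representation seq_scale H ip \<pi> \<and>
            satisfies_relations q H \<pi>}"


subsection \<open>The seminorm dominates all representations on arbitrary Hilbert spaces\<close>

lemma word_star_word_star [simp]: "word_star (word_star w) = w"
  by (cases w) (auto simp: word_star_def rev_map comp_def case_prod_beta)

lemma inj_word_star: "inj word_star"
  by (metis injI word_star_word_star)

lemma free_star_single: "free_star (Poly_Mapping.single w c) = Poly_Mapping.single (word_star w) (cnj c)"
proof -
  have "Poly_Mapping.map cnj (Poly_Mapping.single w c) = Poly_Mapping.single w (cnj c)"
    by (rule poly_mapping_eqI) (auto simp: map.rep_eq when_def lookup_single)
  thus ?thesis
    unfolding free_star_def
    using map_key_single[OF inj_word_star, of "word_star w" "cnj c"] by simp
qed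

lemma lookup_free_scale: "Poly_Mapping.lookup (free_scale c a) w = c * Poly_Mapping.lookup a w"
  by (auto simp: free_scale_def map.rep_eq when_def)

lemma free_alg_expansion:
  "a = (\<Sum>w\<in>Poly_Mapping.keys a. free_scale (Poly_Mapping.lookup a w) (Poly_Mapping.single w 1))"
  by (rule poly_mapping_eqI)
    (auto simp: lookup_sum lookup_free_scale lookup_single when_def in_keys_iff if_distrib cong: if_cong)

lemma free_single_Cons:
  "Poly_Mapping.single (Word (l # ls)) (1::complex) =
     Poly_Mapping.single (Word [l]) 1 * Poly_Mapping.single (Word ls) 1"
  by (simp add: mult_single plus_word_def)

lemma free_single_Nil: "Poly_Mapping.single (Word []) (1::complex) = 1"
  by (metis single_one zero_word_def)

context complex_hilbert_space
begin

lemma H_zero: "0 \<in> H" and H_add: "x \<in> H \<Longrightarrow> y \<in> H \<Longrightarrow> x + y \<in> H"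
  and H_scale: "x \<in> H \<Longrightarrow> scale c x \<in> H" and H_diff: "x \<in> H \<Longrightarrow> y \<in> H \<Longrightarrow> x - y \<in> H"
  using subspace by (auto intro: subspace_0 subspace_add subspace_scale subspace_diff)

lemma ip_zero_right: "x \<in> H \<Longrightarrow> ip x 0 = 0"
  using ip_add[of x 0 0] H_zero by simp

lemma ip_zero_left: "x \<in> H \<Longrightarrow> ip 0 x = 0"
  using ip_zero_right ip_commute H_zero by (metis complex_cnj_zero)

lemma ip_add_left: "\<lbrakk>x \<in> H; y \<in> H; z \<in> H\<rbrakk> \<Longrightarrow> ip (x + y) z = ip x z + ip y z"
  by (metis H_add complex_cnj_add ip_add ip_commute)

lemma ip_scale_left: "\<lbrakk>x \<in> H; y \<in> H\<rbrakk> \<Longrightarrow> ip (scale c x) y = cnj c * ip x y"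
  by (metis H_scale complex_cnj_mult ip_commute ip_scale)

lemma ip_diff: "\<lbrakk>x \<in> H; y \<in> H; z \<in> H\<rbrakk> \<Longrightarrow> ip x (y - z) = ip x y - ip x z"
  by (metis H_diff add_diff_cancel_right' diff_add_cancel ip_add)

lemma ip_self: "x \<in> H \<Longrightarrow> ip x x = complex_of_real ((vec_norm ip x)\<^sup>2)"
proof -
  assume x: "x \<in> H"
  have "Im (ip x x) = 0" using ip_commute[OF x x] by (metis complex_cnj_cancel_iff complex_In_mult_cnj_zero cnj.simps(2) equal_neg_zero)
  moreover have "Re (ip x x) \<ge> 0" using ip_pos[OF x] ip_zero_right[OF x] by (cases "x = 0") auto
  ultimately show ?thesis by (simp add: vec_norm_def complex_eq_iff)
qed

lemma vec_norm_ge0: "x \<in> H \<Longrightarrow> vec_norm ip x \<ge> 0"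
  using ip_pos[of x] ip_zero_right[of x] unfolding vec_norm_def by (cases "x = 0") auto

lemma vec_norm_eq0: "x \<in> H \<Longrightarrow> vec_norm ip x = 0 \<Longrightarrow> x = 0"
  using ip_pos[of x] unfolding vec_norm_def by force

lemma vec_norm_zero [simp]: "vec_norm ip 0 = 0"
  using ip_zero_right[OF H_zero] by (simp add: vec_norm_def)

lemma vec_norm_scale: "x \<in> H \<Longrightarrow> vec_norm ip (scale c x) = cmod c * vec_norm ip x"
proof -
  assume x: "x \<in> H"
  have "ip (scale c x) (scale c x) = (c * cnj c) * ip x x"
    using x by (simp add: ip_scale ip_scale_left H_scale)
  also have "\<dots> = complex_of_real ((cmod c * vec_norm ip x)\<^sup>2)"
    by (simp add: ip_self[OF x] complex_norm_square power_mult_distrib del: of_real_power)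
  finally have "(vec_norm ip (scale c x))\<^sup>2 = (cmod c * vec_norm ip x)\<^sup>2"
    using ip_self[OF H_scale[OF x], of c] by (metis of_real_eq_iff)
  thus ?thesis using vec_norm_ge0[OF H_scale[OF x]] vec_norm_ge0[OF x] by (simp add: power2_eq_iff_nonneg)
qed

lemma cauchy_schwarz: "x \<in> H \<Longrightarrow> y \<in> H \<Longrightarrow> cmod (ip x y) \<le> vec_norm ip x * vec_norm ip y"
proof (cases "x = 0")
  case True
  assume "x \<in> H" "y \<in> H"
  thus ?thesis using True by (simp add: ip_zero_left)
next
  case False
  assume x: "x \<in> H" and y: "y \<in> H"
  define N where "N = (vec_norm ip x)\<^sup>2"
  define c where "c = ip x y"
  have "vec_norm ip x \<noteq> 0" using vec_norm_eq0[OF x] False by blast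
  hence N: "N > 0" by (simp add: N_def)
  define u where "u = scale (of_real N) y - scale c x"
  have u: "u \<in> H" by (simp add: u_def H_diff H_scale x y)
  have xu: "ip x u = 0"
    by (simp add: u_def ip_diff ip_scale x y H_scale ip_self flip: N_def c_def)
  have ux: "ip u x = 0" using ip_commute[OF x u] xu by simp
  have yx: "ip y x = cnj c" using ip_commute[OF x y] by (simp add: c_def)
  have "ip u u = of_real N * ip u y"
  proof -
    have "ip u u = of_real N * ip u y - c * ip u x"
      using u x y by (subst (2) u_def) (simp add: ip_diff ip_scale H_scale)
    thus ?thesis using ux by simp
  qed
  also have "ip u y = cnj (ip y u)" using ip_commute[OF y u] .
  also have "ip y u = of_real N * of_real ((vec_norm ip y)\<^sup>2) - c * cnj c"
    using x y by (simp add: u_def ip_diff ip_scale H_scale ip_self yx del: of_real_power)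
  finally have "ip u u = of_real (N * (N * (vec_norm ip y)\<^sup>2 - (cmod c)\<^sup>2))"
    by (simp add: complex_norm_square mult.commute del: of_real_power)
  hence "N * (N * (vec_norm ip y)\<^sup>2 - (cmod c)\<^sup>2) = (vec_norm ip u)\<^sup>2"
    using ip_self[OF u] by (metis of_real_eq_iff)
  hence "N * (vec_norm ip y)\<^sup>2 - (cmod c)\<^sup>2 \<ge> 0"
    using N by (metis zero_le_mult_iff zero_le_power2 not_less)
  hence "(cmod c)\<^sup>2 \<le> (vec_norm ip x * vec_norm ip y)\<^sup>2" by (simp add: N_def power_mult_distrib)
  thus ?thesis unfolding c_def
    by (rule power2_le_imp_le) (simp add: vec_norm_ge0 x y)
qed

lemma vec_norm_triangle: "x \<in> H \<Longrightarrow> y \<in> H \<Longrightarrow> vec_norm ip (x + y) \<le> vec_norm ip x + vec_norm ip y"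
proof -
  assume x: "x \<in> H" and y: "y \<in> H"
  have "(vec_norm ip (x + y))\<^sup>2 = Re (ip (x + y) (x + y))"
    using ip_self[OF H_add[OF x y]] by simp
  also have "\<dots> = Re (ip x x) + Re (ip y y) + Re (ip x y) + Re (ip y x)"
    using x y by (simp add: ip_add ip_add_left H_add)
  also have "\<dots> = (vec_norm ip x)\<^sup>2 + (vec_norm ip y)\<^sup>2 + 2 * Re (ip x y)"
    using ip_self[OF x] ip_self[OF y] ip_commute[OF x y] by simp
  also have "\<dots> \<le> (vec_norm ip x + vec_norm ip y)\<^sup>2"
    using cauchy_schwarz[OF x y] complex_Re_le_cmod[of "ip x y"] by (simp add: power2_sum)
  finally show ?thesis
    by (rule power2_le_imp_le) (simp add: vec_norm_ge0 x y)
qed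

lemma vec_norm_sum: "finite S \<Longrightarrow> (\<And>i. i \<in> S \<Longrightarrow> f i \<in> H) \<Longrightarrow>
   (\<Sum>i\<in>S. f i) \<in> H \<and> vec_norm ip (\<Sum>i\<in>S. f i) \<le> (\<Sum>i\<in>S. vec_norm ip (f i))"
proof (induction S rule: finite_induct)
  case (insert i S)
  thus ?case using vec_norm_triangle[of "f i" "\<Sum>i\<in>S. f i"] by (auto intro: H_add)
qed (auto simp: H_zero)

lemma vec_norm_minus_commute: "x \<in> H \<Longrightarrow> y \<in> H \<Longrightarrow> vec_norm ip (x - y) = vec_norm ip (y - x)"
  using vec_norm_scale[of "y - x" "-1"] by (simp add: H_diff)

end

locale sphere_representation = complex_hilbert_space scale H ip
  for scale :: "complex \<Rightarrow> 'h::ab_group_add \<Rightarrow> 'h" and H ip +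
  fixes q :: real and \<pi> :: "free_alg \<Rightarrow> 'h \<Rightarrow> 'h"
  assumes rep: "star_representation scale H ip \<pi>" and rel: "satisfies_relations q H \<pi>"
begin

lemma rep_closed: "x \<in> H \<Longrightarrow> \<pi> a x \<in> H"
  and rep_vadd: "x \<in> H \<Longrightarrow> y \<in> H \<Longrightarrow> \<pi> a (x + y) = \<pi> a x + \<pi> a y"
  and rep_vscale: "x \<in> H \<Longrightarrow> \<pi> a (scale c x) = scale c (\<pi> a x)"
  and rep_add: "x \<in> H \<Longrightarrow> \<pi> (a + b) x = \<pi> a x + \<pi> b x"
  and rep_scale: "x \<in> H \<Longrightarrow> \<pi> (free_scale c a) x = scale c (\<pi> a x)"
  and rep_mult: "x \<in> H \<Longrightarrow> \<pi> (a * b) x = \<pi> a (\<pi> b x)"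
  and rep_one: "x \<in> H \<Longrightarrow> \<pi> 1 x = x"
  and rep_star: "x \<in> H \<Longrightarrow> y \<in> H \<Longrightarrow> ip x (\<pi> (free_star a) y) = ip (\<pi> a x) y"
  using rep by (auto simp: star_representation_def bounded_operator_def)

lemma rep_zero: "x \<in> H \<Longrightarrow> \<pi> 0 x = 0"
  using rep_add[of x 0 0] by simp

lemma rep_vdiff: "x \<in> H \<Longrightarrow> y \<in> H \<Longrightarrow> \<pi> a (x - y) = \<pi> a x - \<pi> a y"
  by (metis H_diff add_diff_cancel_right' diff_add_cancel rep_vadd)

lemma rep_vzero: "\<pi> a 0 = 0"
  using rep_vadd[OF H_zero H_zero, of a] by simp

lemma rep_sum: "finite S \<Longrightarrow> x \<in> H \<Longrightarrow> \<pi> (\<Sum>i\<in>S. f i) x = (\<Sum>i\<in>S. \<pi> (f i) x)"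
  by (induction S rule: finite_induct) (auto simp: rep_zero rep_add)

lemma rep_expansion:
  "x \<in> H \<Longrightarrow> \<pi> a x = (\<Sum>w\<in>Poly_Mapping.keys a. scale (Poly_Mapping.lookup a w) (\<pi> (Poly_Mapping.single w 1) x))"
  by (subst free_alg_expansion) (simp add: rep_sum rep_scale)

lemma rep_bounded: "\<exists>C. \<forall>x\<in>H. vec_norm ip (\<pi> a x) \<le> C * vec_norm ip x"
  using rep by (auto simp: star_representation_def bounded_operator_def)

lemma norm_sq_star_mult: "x \<in> H \<Longrightarrow> ip x (\<pi> (free_star a * a) x) = of_real ((vec_norm ip (\<pi> a x))\<^sup>2)"
  using ip_self[OF rep_closed, of x a] by (simp add: rep_mult rep_star rep_closed)

lemma free_star_star_gen: "free_star (free_star (free_gen g)) = free_gen g"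
  by (simp add: free_gen_def free_star_single)

lemma norm_sq_gen_mult_star:
  "x \<in> H \<Longrightarrow> ip x (\<pi> (free_gen g * free_star (free_gen g)) x) = of_real ((vec_norm ip (\<pi> (free_star (free_gen g)) x))\<^sup>2)"
  using norm_sq_star_mult[of x "free_star (free_gen g)"] by (simp only: free_star_star_gen)

lemma relation: "(a, b) \<in> sphere_relations q \<Longrightarrow> x \<in> H \<Longrightarrow> \<pi> a x = \<pi> b x"
  using rel by (auto simp: satisfies_relations_def)

lemma contraction_gen:
  assumes x: "x \<in> H"
  shows "vec_norm ip (\<pi> (free_gen g) x) \<le> vec_norm ip x \<and>
         vec_norm ip (\<pi> (free_star (free_gen g)) x) \<le> vec_norm ip x"
proof -
  let ?n = "vec_norm ip" and ?a = "free_gen Alpha" and ?b = "free_gen Beta" and ?z = "free_gen Zed"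
  have zsq: "ip x (\<pi> (?z^2) x) = of_real ((?n (\<pi> ?z x))\<^sup>2)"
  proof -
    have "\<pi> (?z^2) x = \<pi> (free_star ?z * ?z) x"
      using x relation[of ?z "free_star ?z" "\<pi> ?z x"]
      by (simp add: power2_eq_square rep_mult rep_closed sphere_relations_def Let_def)
    thus ?thesis using norm_sq_star_mult[OF x, of ?z] by simp
  qed
  have "\<pi> (?a * free_star ?a + ?b * free_star ?b + ?z^2) x = x"
    using relation[of _ 1 x] x by (simp add: sphere_relations_def Let_def rep_one)
  hence "ip x x = ip x (\<pi> (?a * free_star ?a) x + \<pi> (?b * free_star ?b) x + \<pi> (?z^2) x)"
    using x by (simp add: rep_add)
  hence "complex_of_real ((?n x)\<^sup>2) = of_real ((?n (\<pi> (free_star ?a) x))\<^sup>2 + (?n (\<pi> (free_star ?b) x))\<^sup>2 + (?n (\<pi> ?z x))\<^sup>2)"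
    using x by (simp only: ip_add ip_self norm_sq_gen_mult_star zsq rep_closed H_add of_real_add)
  hence 1: "(?n x)\<^sup>2 = (?n (\<pi> (free_star ?a) x))\<^sup>2 + (?n (\<pi> (free_star ?b) x))\<^sup>2 + (?n (\<pi> ?z x))\<^sup>2"
    by (metis of_real_eq_iff)
  have "\<pi> (free_star ?a * ?a + free_scale ((of_real q)^2) (free_star ?b * ?b) + ?z^2) x = x"
    using relation[of _ 1 x] x by (simp add: sphere_relations_def Let_def rep_one)
  hence "ip x x = ip x (\<pi> (free_star ?a * ?a) x + scale ((of_real q)^2) (\<pi> (free_star ?b * ?b) x) + \<pi> (?z^2) x)"
    using x by (simp add: rep_add rep_scale)
  hence "complex_of_real ((?n x)\<^sup>2) = of_real ((?n (\<pi> ?a x))\<^sup>2 + q^2 * (?n (\<pi> ?b x))\<^sup>2 + (?n (\<pi> ?z x))\<^sup>2)"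
    using x by (simp only: ip_add ip_scale ip_self norm_sq_star_mult zsq rep_closed H_add H_scale of_real_add of_real_mult of_real_power)
  hence 2: "(?n x)\<^sup>2 = (?n (\<pi> ?a x))\<^sup>2 + q^2 * (?n (\<pi> ?b x))\<^sup>2 + (?n (\<pi> ?z x))\<^sup>2"
    by (metis of_real_eq_iff)
  have "\<pi> (?b * free_star ?b) x = \<pi> (free_star ?b * ?b) x"
    using relation[of "?b * free_star ?b" "free_star ?b * ?b" x] x by (simp add: sphere_relations_def Let_def)
  hence "complex_of_real ((?n (\<pi> ?b x))\<^sup>2) = of_real ((?n (\<pi> (free_star ?b) x))\<^sup>2)"
    using norm_sq_star_mult[OF x, of ?b] norm_sq_gen_mult_star[OF x, of Beta] by simp
  hence 3: "(?n (\<pi> ?b x))\<^sup>2 = (?n (\<pi> (free_star ?b) x))\<^sup>2" by (metis of_real_eq_iff)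
  have 4: "\<pi> (free_star ?z) x = \<pi> ?z x"
    using relation[of ?z "free_star ?z" x] x by (simp add: sphere_relations_def Let_def)
  have le: "r\<^sup>2 \<le> (?n x)\<^sup>2 \<Longrightarrow> r \<le> ?n x" for r
    by (rule power2_le_imp_le) (auto simp: vec_norm_ge0 x)
  have nn: "0 \<le> (?n (\<pi> (free_star ?a) x))\<^sup>2" "0 \<le> (?n (\<pi> (free_star ?b) x))\<^sup>2" "0 \<le> (?n (\<pi> ?z x))\<^sup>2"
    "0 \<le> q^2 * (?n (\<pi> ?b x))\<^sup>2" by auto
  have "?n (\<pi> ?a x) \<le> ?n x" "?n (\<pi> (free_star ?a) x) \<le> ?n x" "?n (\<pi> ?b x) \<le> ?n x"
    "?n (\<pi> (free_star ?b) x) \<le> ?n x" "?n (\<pi> ?z x) \<le> ?n x"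
    by (rule le, use nn 1 2 3 in linarith)+
  thus ?thesis using 4 by (cases g) auto
qed

lemma contraction_word: "x \<in> H \<Longrightarrow> vec_norm ip (\<pi> (Poly_Mapping.single (Word ls) 1) x) \<le> vec_norm ip x"
proof (induction ls)
  case Nil
  thus ?case by (simp add: free_single_Nil rep_one)
next
  case (Cons l ls)
  let ?y = "\<pi> (Poly_Mapping.single (Word ls) 1) x"
  have y: "?y \<in> H" using Cons rep_closed by blast
  obtain g s where l: "l = (g, s)" by (cases l)
  have "vec_norm ip (\<pi> (Poly_Mapping.single (Word [l]) 1) ?y) \<le> vec_norm ip ?y"
  proof (cases s)
    case True
    hence "Poly_Mapping.single (Word [l]) 1 = free_star (free_gen g)"
      by (simp add: free_gen_def free_star_single l word_star_def)
    thus ?thesis using contraction_gen[OF y, of g] by simp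
  next
    case False
    hence "Poly_Mapping.single (Word [l]) 1 = free_gen g"
      by (simp add: free_gen_def l)
    thus ?thesis using contraction_gen[OF y, of g] by simp
  qed
  also have "\<dots> \<le> vec_norm ip x" using Cons by simp
  finally show ?case using Cons by (subst free_single_Cons) (simp add: rep_mult)
qed

lemma rep_norm_bound:
  assumes x: "x \<in> H"
  shows "vec_norm ip (\<pi> a x) \<le> (\<Sum>w\<in>Poly_Mapping.keys a. cmod (Poly_Mapping.lookup a w)) * vec_norm ip x"
proof -
  have "vec_norm ip (\<pi> a x) \<le> (\<Sum>w\<in>Poly_Mapping.keys a. vec_norm ip (scale (Poly_Mapping.lookup a w) (\<pi> (Poly_Mapping.single w 1) x)))"
    using vec_norm_sum[of "Poly_Mapping.keys a"] x by (subst rep_expansion) (auto simp: H_scale rep_closed)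
  also have "\<dots> \<le> (\<Sum>w\<in>Poly_Mapping.keys a. cmod (Poly_Mapping.lookup a w) * vec_norm ip x)"
  proof (rule sum_mono)
    fix w
    show "vec_norm ip (scale (Poly_Mapping.lookup a w) (\<pi> (Poly_Mapping.single w 1) x)) \<le> cmod (Poly_Mapping.lookup a w) * vec_norm ip x"
      using contraction_word[OF x, of "letters w"] x by (simp add: vec_norm_scale rep_closed mult_left_mono)
  qed
  finally show ?thesis by (simp add: sum_distrib_right)
qed

lemma op_norm_nonempty: "{x \<in> H. vec_norm ip x \<le> 1} \<noteq> {}"
  using H_zero by auto

lemma rep_bdd_above: "bdd_above ((\<lambda>x. vec_norm ip (\<pi> a x)) ` {x \<in> H. vec_norm ip x \<le> 1})"
proof (rule bdd_aboveI2)
  fix x assume "x \<in> {x \<in> H. vec_norm ip x \<le> 1}"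
  hence "vec_norm ip (\<pi> a x) \<le> (\<Sum>w\<in>Poly_Mapping.keys a. cmod (Poly_Mapping.lookup a w)) * vec_norm ip x"
    "vec_norm ip x \<le> 1" using rep_norm_bound by auto
  moreover have "(\<Sum>w\<in>Poly_Mapping.keys a. cmod (Poly_Mapping.lookup a w)) \<ge> 0" by (simp add: sum_nonneg)
  ultimately show "vec_norm ip (\<pi> a x) \<le> (\<Sum>w\<in>Poly_Mapping.keys a. cmod (Poly_Mapping.lookup a w))"
    by (meson mult_left_le order_trans)
qed

lemma op_norm_bound: "op_norm H ip (\<pi> a) \<le> (\<Sum>w\<in>Poly_Mapping.keys a. cmod (Poly_Mapping.lookup a w))"
  unfolding op_norm_def
proof (rule cSUP_least[OF op_norm_nonempty])
  fix x assume "x \<in> {x \<in> H. vec_norm ip x \<le> 1}"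
  hence "vec_norm ip (\<pi> a x) \<le> (\<Sum>w\<in>Poly_Mapping.keys a. cmod (Poly_Mapping.lookup a w)) * vec_norm ip x"
    "vec_norm ip x \<le> 1" using rep_norm_bound by auto
  moreover have "(\<Sum>w\<in>Poly_Mapping.keys a. cmod (Poly_Mapping.lookup a w)) \<ge> 0" by (simp add: sum_nonneg)
  ultimately show "vec_norm ip (\<pi> a x) \<le> (\<Sum>w\<in>Poly_Mapping.keys a. cmod (Poly_Mapping.lookup a w))"
    by (meson mult_left_le order_trans)
qed

end

lemma op_norm_le_sphere_seminorm_seq:
  assumes "complex_hilbert_space seq_scale H ip" "star_representation seq_scale H ip \<pi>"
    "satisfies_relations q H \<pi>"
  shows "op_norm H ip (\<pi> a) \<le> sphere_seminorm q a"
  unfolding sphere_seminorm_def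
proof (rule cSup_upper)
  show "bdd_above {op_norm H ip (\<pi> a) | H ip \<pi>. complex_hilbert_space seq_scale H ip \<and>
            star_representation seq_scale H ip \<pi> \<and> satisfies_relations q H \<pi>}"
    unfolding bdd_above_def
    using sphere_representation.op_norm_bound[of seq_scale _ _ q _ a]
    by (auto simp: sphere_representation_def sphere_representation_axioms_def
        intro!: exI[of _ "\<Sum>w\<in>Poly_Mapping.keys a. cmod (Poly_Mapping.lookup a w)"])
qed (use assms in auto)


instance generator :: countable by countable_datatype
instance word :: countable by countable_datatype

lemma vector_space_seq_scale: "vector_space seq_scale"
  by unfold_locales (auto simp: seq_scale_def fun_eq_iff algebra_simps)

context sphere_representation
begin

lemma ip_sum_left: "finite S \<Longrightarrow> (\<And>i. i \<in> S \<Longrightarrow> f i \<in> H) \<Longrightarrow> y \<in> H \<Longrightarrow>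
    ip (\<Sum>i\<in>S. f i) y = (\<Sum>i\<in>S. ip (f i) y)"
proof (induction S rule: finite_induct)
  case (insert i S)
  thus ?case using vec_norm_sum[of S f] by (simp add: ip_add_left)
qed (simp add: ip_zero_left)

text \<open>The closure of the cyclic subspace generated by \<open>v\<close> is transported to \<open>\<complex>\<^bsup>\<nat>\<^esup>\<close> by taking inner
  products with the vectors \<open>\<pi> w v\<close>, where \<open>w\<close> runs through the countably many words.\<close>

lemma rep_norm_le_sphere_seminorm:
  assumes v: "v \<in> H" "vec_norm ip v \<le> 1"
  shows "vec_norm ip (\<pi> a v) \<le> sphere_seminorm q a"
proof -
  define K where "K = {x \<in> H. \<forall>e>0. \<exists>b. vec_norm ip (x - \<pi> b v) < e}"
  define J where "J x = (\<lambda>n. ip (\<pi> (Poly_Mapping.single (from_nat n) 1) v) x)" for x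
  have KH: "x \<in> H" if "x \<in> K" for x using that by (simp add: K_def)
  have K_approx: "\<exists>b. vec_norm ip (x - \<pi> b v) < e" if "x \<in> K" "e > 0" for x e
    using that by (simp add: K_def)
  have K_pi: "\<pi> b v \<in> K" for b
    using v by (auto simp: K_def rep_closed intro!: exI[of _ b])
  have K_zero: "0 \<in> K" using K_pi[of 0] v by (simp add: rep_zero)
  have K_add: "x + y \<in> K" if xy: "x \<in> K" "y \<in> K" for x y
    unfolding K_def
  proof (safe)
    show "x + y \<in> H" using xy KH H_add by blast
    fix e :: real assume "e > 0"
    then obtain b c where b: "vec_norm ip (x - \<pi> b v) < e/2" and c: "vec_norm ip (y - \<pi> c v) < e/2"
      using K_approx[OF xy(1), of "e/2"] K_approx[OF xy(2), of "e/2"] by auto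
    have "x + y - \<pi> (b + c) v = (x - \<pi> b v) + (y - \<pi> c v)"
      using v by (simp add: rep_add)
    hence "vec_norm ip (x + y - \<pi> (b + c) v) \<le> vec_norm ip (x - \<pi> b v) + vec_norm ip (y - \<pi> c v)"
      using vec_norm_triangle xy KH v rep_closed H_diff by metis
    thus "\<exists>b. vec_norm ip (x + y - \<pi> b v) < e" using b c by (intro exI[of _ "b + c"]) simp
  qed
  have K_pi': "\<pi> b x \<in> K" if x: "x \<in> K" for b x
    unfolding K_def
  proof (safe)
    show "\<pi> b x \<in> H" using x KH rep_closed by blast
    fix e :: real assume e: "e > 0"
    obtain C where C: "\<And>y. y \<in> H \<Longrightarrow> vec_norm ip (\<pi> b y) \<le> C * vec_norm ip y"
      using rep_bounded[of b] by blast
    obtain c where c: "vec_norm ip (x - \<pi> c v) < e / (\<bar>C\<bar> + 1)"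
      using K_approx[OF x, of "e / (\<bar>C\<bar> + 1)"] e by auto
    have d: "x - \<pi> c v \<in> H" using x KH v rep_closed H_diff by blast
    have "vec_norm ip (\<pi> b x - \<pi> (b * c) v) = vec_norm ip (\<pi> b (x - \<pi> c v))"
      using v x by (simp add: rep_mult rep_vdiff KH rep_closed)
    also have "\<dots> \<le> C * vec_norm ip (x - \<pi> c v)" using C d by blast
    also have "\<dots> \<le> (\<bar>C\<bar> + 1) * vec_norm ip (x - \<pi> c v)"
      using vec_norm_ge0[OF d] by (intro mult_right_mono) auto
    also have "\<dots> < e" using c by (simp add: field_simps)
    finally show "\<exists>b'. vec_norm ip (\<pi> b x - \<pi> b' v) < e" by blast
  qed
  have K_scale: "scale c x \<in> K" if x: "x \<in> K" for c x
    using K_pi'[OF x, of "free_scale c 1"] KH[OF x] by (simp add: rep_scale rep_one)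
  have K_diff: "x - y \<in> K" if "x \<in> K" "y \<in> K" for x y
    using K_add[OF that(1) K_scale[OF that(2), of "-1"]] by simp
  have K_complete: "\<exists>x\<in>K. (\<lambda>n. vec_norm ip (s n - x)) \<longlonglongrightarrow> 0"
    if s: "\<And>n::nat. s n \<in> K"
      and cs: "\<And>e. e > 0 \<Longrightarrow> \<exists>N. \<forall>m\<ge>N. \<forall>n\<ge>N. vec_norm ip (s m - s n) < e" for s
  proof -
    obtain x where x: "x \<in> H" and lim: "(\<lambda>n. vec_norm ip (s n - x)) \<longlonglongrightarrow> 0"
      using complete[of s] s cs KH by blast
    have "x \<in> K"
      unfolding K_def
    proof (safe)
      fix e :: real assume "e > 0"
      hence "\<forall>\<^sub>F n in sequentially. vec_norm ip (s n - x) < e/2"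
        by (intro order_tendstoD(2)[OF lim]) simp
      then obtain n where n: "vec_norm ip (s n - x) < e/2"
        by (auto simp: eventually_sequentially)
      obtain b where b: "vec_norm ip (s n - \<pi> b v) < e/2"
        using K_approx[OF s[of n], of "e/2"] \<open>e > 0\<close> by auto
      have "x - \<pi> b v = (x - s n) + (s n - \<pi> b v)" by simp
      hence "vec_norm ip (x - \<pi> b v) \<le> vec_norm ip (x - s n) + vec_norm ip (s n - \<pi> b v)"
        using vec_norm_triangle[of "x - s n" "s n - \<pi> b v"] x KH[OF s[of n]] rep_closed[OF v(1)]
        by (simp add: H_diff)
      thus "\<exists>b. vec_norm ip (x - \<pi> b v) < e"
        using n b vec_norm_minus_commute[OF x KH[OF s[of n]]] by (intro exI[of _ b]) simp
    qed (use x in auto)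
    thus ?thesis using lim by blast
  qed
  have J_add: "J (x + y) = J x + J y" if "x \<in> H" "y \<in> H" for x y
    using that v by (auto simp: J_def fun_eq_iff ip_add rep_closed)
  have J_scale: "J (scale c x) = seq_scale c (J x)" if "x \<in> H" for c x
    using that v by (auto simp: J_def fun_eq_iff ip_scale rep_closed seq_scale_def)
  have J_diff: "J (x - y) = J x - J y" if "x \<in> H" "y \<in> H" for x y
    using that v by (auto simp: J_def fun_eq_iff ip_diff rep_closed)
  have J_zero: "J 0 = 0" using J_diff[OF H_zero H_zero] by simp
  have J_null: "x = 0" if x: "x \<in> K" and J0: "J x = 0" for x
  proof (rule ccontr)
    assume "x \<noteq> 0"
    have xH: "x \<in> H" using x KH by blast
    have pos: "vec_norm ip x > 0"
      using vec_norm_ge0[OF xH] vec_norm_eq0[OF xH] \<open>x \<noteq> 0\<close> by force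
    have w0: "ip (\<pi> (Poly_Mapping.single w 1) v) x = 0" for w
      using fun_cong[OF J0, of "to_nat w"] by (simp add: J_def)
    have orth: "ip (\<pi> b v) x = 0" for b
      using v xH by (subst rep_expansion)
        (auto simp: ip_sum_left ip_scale_left H_scale rep_closed w0)
    obtain b where b: "vec_norm ip (x - \<pi> b v) < vec_norm ip x" using K_approx[OF x pos] by blast
    have d: "x - \<pi> b v \<in> H" using xH v rep_closed H_diff by blast
    have "ip x x = ip (x - \<pi> b v) x + ip (\<pi> b v) x"
      using ip_add_left[OF d rep_closed[OF v(1)] xH, of b] by simp
    hence "cmod (ip x x) \<le> vec_norm ip (x - \<pi> b v) * vec_norm ip x"
      using cauchy_schwarz[OF d xH] orth by simp
    moreover have "cmod (ip x x) = vec_norm ip x * vec_norm ip x"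
      using pos by (simp add: ip_self[OF xH] norm_mult power2_eq_square)
    ultimately show False using b pos by simp
  qed
  have J_inj: "inj_on J K"
  proof (rule inj_onI)
    fix x y assume "x \<in> K" "y \<in> K" "J x = J y"
    thus "x = y" using J_null[of "x - y"] J_diff[of x y] K_diff[of x y] KH by simp
  qed
  define L where "L = inv_into K J"
  have L [simp]: "L (J x) = x" if "x \<in> K" for x using J_inj that by (simp add: L_def)
  define ip' where "ip' f g = ip (L f) (L g)" for f g
  define \<pi>' where "\<pi>' b f = J (\<pi> b (L f))" for b f
  have n': "vec_norm ip' (J x) = vec_norm ip x" if "x \<in> K" for x
    using that by (simp add: vec_norm_def ip'_def)
  have vs: "vector_space seq_scale" by (rule vector_space_seq_scale)
  have add': "J x + J y = J (x + y)" if "x \<in> K" "y \<in> K" for x y using that KH J_add by simp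
  have diff': "J x - J y = J (x - y)" if "x \<in> K" "y \<in> K" for x y using that KH J_diff by simp
  have scale': "seq_scale c (J x) = J (scale c x)" if "x \<in> K" for c x using that KH J_scale by simp
  have hilb: "complex_hilbert_space seq_scale (J ` K) ip'"
  proof (intro complex_hilbert_space.intro complex_hilbert_space_axioms.intro vs)
    interpret S: vector_space seq_scale by (rule vs)
    show "S.subspace (J ` K)"
      by (rule S.subspaceI)
        (use K_zero J_zero in \<open>force simp: add' scale' intro!: imageI K_add K_scale\<close>)+
  next
    fix f g h assume "f \<in> J ` K" "g \<in> J ` K" "h \<in> J ` K"
    thus "ip' f (g + h) = ip' f g + ip' f h"
      by (auto simp: add' ip'_def K_add ip_add KH)
  next
    fix f g c assume "f \<in> J ` K" "g \<in> J ` K"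
    thus "ip' f (seq_scale c g) = c * ip' f g"
      by (auto simp: scale' ip'_def K_scale ip_scale KH)
  next
    fix f g assume "f \<in> J ` K" "g \<in> J ` K"
    thus "ip' g f = cnj (ip' f g)"
      by (auto simp: ip'_def KH intro: ip_commute)
  next
    fix f assume "f \<in> J ` K" "f \<noteq> 0"
    thus "0 < Re (ip' f f)"
      by (auto simp: ip'_def KH J_zero intro!: ip_pos)
  next
    fix s :: "nat \<Rightarrow> nat \<Rightarrow> complex"
    assume s: "\<And>n. s n \<in> J ` K"
      and cs: "\<And>e. e > 0 \<Longrightarrow> \<exists>N. \<forall>m\<ge>N. \<forall>n\<ge>N. vec_norm ip' (s m - s n) < e"
    define t where "t n = L (s n)" for n
    have t: "t n \<in> K" and st: "s n = J (t n)" for n using s[of n] by (auto simp: t_def)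
    have "vec_norm ip' (s m - s n) = vec_norm ip (t m - t n)" for m n
      using t by (simp add: st diff' n' K_diff)
    hence "\<exists>x\<in>K. (\<lambda>n. vec_norm ip (t n - x)) \<longlonglongrightarrow> 0"
      using K_complete[of t] t cs by simp
    then obtain x where x: "x \<in> K" "(\<lambda>n. vec_norm ip (t n - x)) \<longlonglongrightarrow> 0" by blast
    have "vec_norm ip' (s n - J x) = vec_norm ip (t n - x)" for n
      using t x by (simp add: st diff' n' K_diff)
    thus "\<exists>f\<in>J ` K. (\<lambda>n. vec_norm ip' (s n - f)) \<longlonglongrightarrow> 0"
      using x by (intro bexI[of _ "J x"]) auto
  qed
  have bdd: "bounded_operator seq_scale (J ` K) ip' (\<pi>' b)" for b
  proof -
    obtain C where C: "\<And>y. y \<in> H \<Longrightarrow> vec_norm ip (\<pi> b y) \<le> C * vec_norm ip y"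
      using rep_bounded[of b] by blast
    show ?thesis
      unfolding bounded_operator_def
      by (auto simp: \<pi>'_def add' scale' K_pi' K_add K_scale rep_vadd rep_vscale KH n' C intro!: exI[of _ C])
  qed
  have srep: "star_representation seq_scale (J ` K) ip' \<pi>'"
    unfolding star_representation_def
    using bdd by (auto simp: \<pi>'_def add' scale' K_pi' rep_add rep_scale rep_mult rep_one rep_star ip'_def KH)
  have srel: "satisfies_relations q (J ` K) \<pi>'"
    unfolding satisfies_relations_def using relation KH by (fastforce simp: \<pi>'_def)
  interpret R: sphere_representation seq_scale "J ` K" ip' q \<pi>'
    using hilb srep srel by (simp add: sphere_representation_def sphere_representation_axioms_def)
  have vK: "v \<in> K" using K_pi[of 1] v by (simp add: rep_one)
  have "vec_norm ip (\<pi> a v) = vec_norm ip' (\<pi>' a (J v))"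
    using vK by (simp add: \<pi>'_def n' K_pi')
  also have "\<dots> \<le> op_norm (J ` K) ip' (\<pi>' a)"
    unfolding op_norm_def
    by (rule cSUP_upper[OF _ R.rep_bdd_above]) (use vK v in \<open>simp add: n'\<close>)
  also have "\<dots> \<le> sphere_seminorm q a"
    by (rule op_norm_le_sphere_seminorm_seq[OF hilb srep srel])
  finally show ?thesis .
qed

theorem op_norm_le_sphere_seminorm: "op_norm H ip (\<pi> a) \<le> sphere_seminorm q a"
  unfolding op_norm_def
  by (rule cSUP_least[OF op_norm_nonempty]) (auto intro: rep_norm_le_sphere_seminorm)

end


section \<open>Separated quotient and completion of seminormed *-algebras\<close>

record 'a star_algebra = "(complex, 'a) module" +
  star :: "'a \<Rightarrow> 'a"

record 'a normed_star_algebra = "'a star_algebra" +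
  nrm :: "'a \<Rightarrow> real"

definition null_ideal :: "('a, 'm) normed_star_algebra_scheme \<Rightarrow> 'a set" where
  "null_ideal A = {a \<in> carrier A. nrm A a = 0}"

text \<open>On a coset \<open>X\<close> of the null ideal the seminorm is constant; its value is the norm of \<open>X\<close>.\<close>

definition separated_quotient :: "'a normed_star_algebra \<Rightarrow> 'a set normed_star_algebra" where
  "separated_quotient A = (let I = null_ideal A in
    \<lparr>carrier = carrier (A Quot I), monoid.mult = monoid.mult (A Quot I), one = one (A Quot I),
     zero = zero (A Quot I), add = add (A Quot I),
     module.smult = (\<lambda>c X. \<Union>x\<in>X. I +>\<^bsub>A\<^esub> (c \<odot>\<^bsub>A\<^esub> x)),
     star = (\<lambda>X. \<Union>x\<in>X. I +>\<^bsub>A\<^esub> star A x),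
     nrm = (\<lambda>X. the_elem (nrm A ` X))\<rparr>)"

definition cauchy_algebra :: "'a normed_star_algebra \<Rightarrow> (nat \<Rightarrow> 'a) normed_star_algebra" where
  "cauchy_algebra A =
    \<lparr>carrier = {s. (\<forall>n. s n \<in> carrier A) \<and>
                   (\<forall>e>0. \<exists>N. \<forall>m\<ge>N. \<forall>n\<ge>N. nrm A (s m \<ominus>\<^bsub>A\<^esub> s n) < e)},
     monoid.mult = (\<lambda>s t n. s n \<otimes>\<^bsub>A\<^esub> t n), one = (\<lambda>n. \<one>\<^bsub>A\<^esub>),
     zero = (\<lambda>n. \<zero>\<^bsub>A\<^esub>), add = (\<lambda>s t n. s n \<oplus>\<^bsub>A\<^esub> t n),
     module.smult = (\<lambda>c s n. c \<odot>\<^bsub>A\<^esub> s n),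
     star = (\<lambda>s n. star A (s n)),
     nrm = (\<lambda>s. lim (\<lambda>n. nrm A (s n)))\<rparr>"

text \<open>The null ideal of \<open>cauchy_algebra A\<close> consists of the sequences converging to 0.\<close>

definition completion :: "'a normed_star_algebra \<Rightarrow> (nat \<Rightarrow> 'a) set normed_star_algebra" where
  "completion A = separated_quotient (cauchy_algebra A)"

definition completion_embedding :: "'a normed_star_algebra \<Rightarrow> 'a \<Rightarrow> (nat \<Rightarrow> 'a) set" where
  "completion_embedding A a =
     null_ideal (cauchy_algebra A) +>\<^bsub>cauchy_algebra A\<^esub> (\<lambda>n. a)"


section \<open>The algebra of the quantum 4-sphere\<close>

definition free_sphere_algebra :: "real \<Rightarrow> free_alg normed_star_algebra" where
  "free_sphere_algebra q =
    \<lparr>carrier = UNIV, monoid.mult = (*), one = 1, zero = 0, add = (+),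
     module.smult = free_scale, star = free_star, nrm = sphere_seminorm q\<rparr>"

definition sphere_algebra :: "real \<Rightarrow> (nat \<Rightarrow> free_alg set) set normed_star_algebra" where
  "sphere_algebra q = completion (separated_quotient (free_sphere_algebra q))"

definition sphere_gen :: "real \<Rightarrow> generator \<Rightarrow> (nat \<Rightarrow> free_alg set) set" where
  "sphere_gen q g =
     completion_embedding (separated_quotient (free_sphere_algebra q))
       (null_ideal (free_sphere_algebra q) +>\<^bsub>free_sphere_algebra q\<^esub> free_gen g)"


section \<open>Matrices over a *-algebra\<close>

definition matrix_algebra :: "nat \<Rightarrow> ('a, 'm) star_algebra_scheme \<Rightarrow> 'a mat star_algebra" where
  "matrix_algebra n A =
    \<lparr>carrier = {M \<in> carrier_mat n n. elements_mat M \<subseteq> carrier A},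
     monoid.mult = (\<lambda>M N. mat n n (\<lambda>(i, j). \<Oplus>\<^bsub>A\<^esub>k\<in>{..<n}. M $$ (i, k) \<otimes>\<^bsub>A\<^esub> N $$ (k, j))),
     one = mat n n (\<lambda>(i, j). if i = j then \<one>\<^bsub>A\<^esub> else \<zero>\<^bsub>A\<^esub>),
     zero = mat n n (\<lambda>(i, j). \<zero>\<^bsub>A\<^esub>),
     add = (\<lambda>M N. mat n n (\<lambda>(i, j). M $$ (i, j) \<oplus>\<^bsub>A\<^esub> N $$ (i, j))),
     module.smult = (\<lambda>c M. mat n n (\<lambda>(i, j). c \<odot>\<^bsub>A\<^esub> M $$ (i, j))),
     star = (\<lambda>M. mat n n (\<lambda>(i, j). star A (M $$ (j, i))))\<rparr>"

end

theory Submission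
  imports Defs
begin

text \<open>
  Squaring \<open>2 e\<close> produces in each entry a combination of the defining relations and their adjoints:
  \<open>(2 e)\<^sup>2 - 2 (2 e)\<close> vanishes because \<open>\<alpha> \<alpha>\<^sup>* + \<beta> \<beta>\<^sup>* + z\<^sup>2\<close> and \<open>\<alpha>\<^sup>* \<alpha> + q\<^sup>2 \<beta>\<^sup>* \<beta> + z\<^sup>2\<close> equal one,
  \<open>\<beta>\<close> is normal and \<open>q\<close>-commutes with \<open>\<alpha>\<close>, and \<open>z\<close> is central. Selfadjointness is visible from the
  matrix and \<open>z = z\<^sup>*\<close>. This calculation is done in the free *-algebra, modulo the kernel of a
  *-homomorphism that respects the relations (\<open>entries_square\<close>, \<open>entries_star\<close>,
  \<open>projection_matrix\<close>).

  What remains is that the free algebra really maps to the algebra of the sphere by such a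
  homomorphism. That algebra is a tower: the separated quotient of the free algebra by the universal
  seminorm, then Cauchy sequences in it, then the quotient by the null sequences. The operations of
  each stage are well defined because they are continuous for the seminorm, and this continuity is
  passed on to the next stage (\<open>seminormed_separated_quotient\<close>, \<open>seminormed_cauchy_algebra\<close>). At the
  bottom of the tower it comes from the Hilbert space estimates for representations, through the
  characterisation of the seminorm as the least bound common to all representations
  (\<open>rep_norm_le\<close>, \<open>sphere_seminorm_leI\<close>). The two sides of a relation act equally in every
  representation, so their difference has seminorm zero (\<open>sphere_seminorm_relation\<close>) and their
  images coincide.
\<close>


section \<open>The *-algebra structure of the free algebra\<close>

lemma free_alg_induct [case_names single add]:
  assumes single: "\<And>w c. P (Poly_Mapping.single w c)"
    and add: "\<And>a b. P a \<Longrightarrow> P b \<Longrightarrow> P (a + b)"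
  shows "P (a :: free_alg)"
proof -
  have term_eq: "free_scale c (Poly_Mapping.single w 1) = Poly_Mapping.single w c" for c w
    by (rule poly_mapping_eqI) (auto simp: lookup_free_scale lookup_single when_def)
  have zero: "P 0" using single[of 0 0] by simp
  have "P (\<Sum>w\<in>S. Poly_Mapping.single w (f w))" if "finite S" for S f
    using that by (induction S rule: finite_induct) (auto intro: zero single add)
  thus ?thesis by (subst free_alg_expansion) (simp add: term_eq)
qed

lemma lookup_free_star:
  "Poly_Mapping.lookup (free_star a) w = cnj (Poly_Mapping.lookup a (word_star w))"
  by (auto simp: free_star_def map_key.rep_eq[OF inj_word_star] map.rep_eq when_def)

lemma free_star_add: "free_star (a + b) = free_star a + free_star b"
  by (rule poly_mapping_eqI) (simp add: lookup_free_star lookup_add)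

lemma free_star_diff: "free_star (a - b) = free_star a - free_star b"
  by (rule poly_mapping_eqI) (simp add: lookup_free_star lookup_minus)

lemma free_star_zero: "free_star 0 = 0"
  by (rule poly_mapping_eqI) (simp add: lookup_free_star)

lemma free_star_scale: "free_star (free_scale c a) = free_scale (cnj c) (free_star a)"
  by (rule poly_mapping_eqI) (simp add: lookup_free_star lookup_free_scale)

lemma free_star_star: "free_star (free_star a) = a"
  by (rule poly_mapping_eqI) (simp add: lookup_free_star)

lemma free_star_one: "free_star 1 = 1"
proof -
  have "word_star 0 = 0" by (simp add: word_star_def zero_word_def)
  thus ?thesis using free_star_single[of 0 1] by simp
qed

lemma word_star_add: "word_star (v + w) = word_star w + word_star v"
  by (simp add: word_star_def plus_word_def)

lemma free_star_mult: "free_star (a * b) = free_star b * free_star a"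
proof (induction a rule: free_alg_induct)
  case (single v c)
  show ?case
    by (induction b rule: free_alg_induct)
      (simp_all add: mult_single free_star_single word_star_add free_star_add algebra_simps)
qed (simp add: free_star_add algebra_simps)

lemma free_scale_add: "free_scale c (a + b) = free_scale c a + free_scale c b"
  and free_scale_diff: "free_scale c (a - b) = free_scale c a - free_scale c b"
  and free_scale_minus_scalar: "free_scale (- c) a = - free_scale c a"
  and free_scale_scale: "free_scale c (free_scale d a) = free_scale (c * d) a"
  and free_scale_one: "free_scale 1 a = a"
  and free_scale_zero: "free_scale c 0 = 0"
  and free_scale_uminus: "free_scale c (- a) = - free_scale c a"
  and free_scale_two: "free_scale 2 a = a + a"
  by (rule poly_mapping_eqI,
      simp add: lookup_free_scale lookup_add lookup_minus algebra_simps)+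

lemma free_scale_mult_left: "free_scale c a * b = free_scale c (a * b)"
  by (simp add: free_scale_def mult_map_scale_conv_mult mult.assoc)

text \<open>Scaling is left multiplication by a multiple of the empty word, which is central.\<close>

lemma free_scale_mult_right: "a * free_scale c b = free_scale c (a * b)"
proof -
  have "a * Poly_Mapping.single 0 c = Poly_Mapping.single 0 c * a"
    by (induction a rule: free_alg_induct) (simp_all add: mult_single mult.commute algebra_simps)
  thus ?thesis
    by (simp add: free_scale_def mult_map_scale_conv_mult flip: mult.assoc)
qed


section \<open>The universal seminorm\<close>

text \<open>The zero space satisfies every relation, so the supremum defining the seminorm ranges over a
  non-empty set. This is what makes upper bounds on all representations bound the seminorm, since
  the real supremum of the empty set is an unspecified number.\<close>

lemma zero_sphere_representation: "sphere_representation seq_scale {0} (\<lambda>x y. 0) q (\<lambda>a x. 0)"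
proof -
  interpret S: vector_space seq_scale by (rule vector_space_seq_scale)
  have sc: "seq_scale c 0 = 0" for c by (simp add: seq_scale_def fun_eq_iff)
  have "complex_hilbert_space seq_scale {0} (\<lambda>x y. 0)"
    by unfold_locales (auto simp: S.subspace_def sc vec_norm_def)
  moreover have "star_representation seq_scale {0} (\<lambda>x y. 0) (\<lambda>a x. 0)"
    by (auto simp: star_representation_def bounded_operator_def sc vec_norm_def)
  moreover have "satisfies_relations q {0} (\<lambda>a x. 0)"
    by (auto simp: satisfies_relations_def)
  ultimately show ?thesis
    by (simp add: sphere_representation_def sphere_representation_axioms_def)
qed

text \<open>Rescaling to the unit ball turns the domination of all representations into an operator
  bound, the form that composes under products.\<close>

lemma (in sphere_representation) rep_norm_le:
  assumes x: "x \<in> H"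
  shows "vec_norm ip (\<pi> a x) \<le> sphere_seminorm q a * vec_norm ip x"
proof (cases "x = 0")
  case True
  thus ?thesis by (simp add: rep_vzero)
next
  case False
  define r where "r = vec_norm ip x"
  have r: "r > 0"
    using vec_norm_ge0[OF x] vec_norm_eq0[OF x] False by (force simp: r_def)
  define y where "y = scale (of_real (1 / r)) x"
  have y: "y \<in> H" using x by (simp add: y_def H_scale)
  have "vec_norm ip y = 1"
    using r x by (simp only: y_def vec_norm_scale norm_of_real r_def[symmetric]) simp
  hence "vec_norm ip (\<pi> a y) \<le> sphere_seminorm q a"
    using rep_norm_le_sphere_seminorm[OF y, of a] by simp
  moreover have "vec_norm ip (\<pi> a y) = vec_norm ip (\<pi> a x) / r"
    using r x rep_closed[OF x, of a]
    by (simp only: y_def rep_vscale vec_norm_scale norm_of_real) simp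
  ultimately show ?thesis using r by (simp add: r_def field_simps)
qed

text \<open>Together with \<open>rep_norm_le\<close>, this characterises the seminorm as the least bound common to all
  representations; the remaining properties are read off one vector at a time.\<close>

lemma sphere_seminorm_leI:
  assumes "\<And>H ip \<pi> x. sphere_representation seq_scale H ip q \<pi> \<Longrightarrow> x \<in> H \<Longrightarrow> vec_norm ip x \<le> 1
             \<Longrightarrow> vec_norm ip (\<pi> a x) \<le> B"
  shows "sphere_seminorm q a \<le> B"
  unfolding sphere_seminorm_def
proof (rule cSup_least)
  show "{op_norm H ip (\<pi> a) | H ip \<pi>. complex_hilbert_space seq_scale H ip \<and>
            star_representation seq_scale H ip \<pi> \<and> satisfies_relations q H \<pi>} \<noteq> {}"
    using zero_sphere_representation[of q]
    unfolding sphere_representation_def sphere_representation_axioms_def by blast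
next
  fix t
  assume "t \<in> {op_norm H ip (\<pi> a) | H ip \<pi>. complex_hilbert_space seq_scale H ip \<and>
            star_representation seq_scale H ip \<pi> \<and> satisfies_relations q H \<pi>}"
  then obtain H ip \<pi> where t: "t = op_norm H ip (\<pi> a)"
    and R: "sphere_representation seq_scale H ip q \<pi>"
    unfolding sphere_representation_def sphere_representation_axioms_def by blast
  interpret sphere_representation seq_scale H ip q \<pi> by (rule R)
  show "t \<le> B"
    unfolding t op_norm_def
    by (rule cSUP_least[OF op_norm_nonempty]) (use assms[OF R] in auto)
qed

lemma sphere_seminorm_nonneg: "0 \<le> sphere_seminorm q a"
proof -
  interpret sphere_representation seq_scale "{0}" "\<lambda>x y. 0" q "\<lambda>a x. 0"
    by (rule zero_sphere_representation)
  show ?thesis using rep_norm_le_sphere_seminorm[of 0 a] by simp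
qed

lemma (in sphere_representation) rep_minus: "x \<in> H \<Longrightarrow> \<pi> (- a) x = - \<pi> a x"
  using rep_add[of x "- a" a] rep_zero[of x] by (simp add: eq_neg_iff_add_eq_0)

lemma (in sphere_representation) rep_diff: "x \<in> H \<Longrightarrow> \<pi> (a - b) x = \<pi> a x - \<pi> b x"
  using rep_add[of x a "- b"] by (simp add: rep_minus)

lemma sphere_seminorm_zero: "sphere_seminorm q 0 = 0"
proof (rule antisym[OF sphere_seminorm_leI sphere_seminorm_nonneg])
  fix H ip \<pi> x
  assume "sphere_representation seq_scale H ip q \<pi>" and x: "x \<in> H"
  then interpret sphere_representation seq_scale H ip q \<pi> by simp
  show "vec_norm ip (\<pi> 0 x) \<le> 0" using x by (simp add: rep_zero)
qed

lemma sphere_seminorm_add: "sphere_seminorm q (a + b) \<le> sphere_seminorm q a + sphere_seminorm q b"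
proof (rule sphere_seminorm_leI)
  fix H ip \<pi> x
  assume "sphere_representation seq_scale H ip q \<pi>" and x: "x \<in> H" "vec_norm ip x \<le> 1"
  then interpret sphere_representation seq_scale H ip q \<pi> by simp
  have "vec_norm ip (\<pi> (a + b) x) \<le> vec_norm ip (\<pi> a x) + vec_norm ip (\<pi> b x)"
    using x by (simp add: rep_add vec_norm_triangle rep_closed)
  thus "vec_norm ip (\<pi> (a + b) x) \<le> sphere_seminorm q a + sphere_seminorm q b"
    using rep_norm_le_sphere_seminorm[OF x, of a] rep_norm_le_sphere_seminorm[OF x, of b] by linarith
qed

lemma sphere_seminorm_scale: "sphere_seminorm q (free_scale c a) \<le> cmod c * sphere_seminorm q a"
proof (rule sphere_seminorm_leI)
  fix H ip \<pi> x
  assume "sphere_representation seq_scale H ip q \<pi>" and x: "x \<in> H" "vec_norm ip x \<le> 1"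
  then interpret sphere_representation seq_scale H ip q \<pi> by simp
  show "vec_norm ip (\<pi> (free_scale c a) x) \<le> cmod c * sphere_seminorm q a"
    using rep_norm_le_sphere_seminorm[OF x, of a] x
    by (simp add: rep_scale vec_norm_scale rep_closed mult_left_mono)
qed

lemma sphere_seminorm_mult: "sphere_seminorm q (a * b) \<le> sphere_seminorm q a * sphere_seminorm q b"
proof (rule sphere_seminorm_leI)
  fix H ip \<pi> x
  assume "sphere_representation seq_scale H ip q \<pi>" and x: "x \<in> H" "vec_norm ip x \<le> 1"
  then interpret sphere_representation seq_scale H ip q \<pi> by simp
  have "vec_norm ip (\<pi> (a * b) x) \<le> sphere_seminorm q a * vec_norm ip (\<pi> b x)"
    using x rep_norm_le[OF rep_closed] by (simp add: rep_mult)
  also have "\<dots> \<le> sphere_seminorm q a * sphere_seminorm q b"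
    using rep_norm_le_sphere_seminorm[OF x, of b] sphere_seminorm_nonneg by (intro mult_left_mono)
  finally show "vec_norm ip (\<pi> (a * b) x) \<le> sphere_seminorm q a * sphere_seminorm q b" .
qed

text \<open>The vector \<open>y = \<pi> (a\<^sup>*) x\<close> satisfies \<open>\<parallel>y\<parallel>\<^sup>2 = \<langle>\<pi> a y, x\<rangle> \<le> \<parallel>a\<parallel> \<parallel>y\<parallel> \<parallel>x\<parallel>\<close>, and \<open>\<parallel>y\<parallel>\<close> cancels.\<close>

lemma sphere_seminorm_star: "sphere_seminorm q (free_star a) \<le> sphere_seminorm q a"
proof (rule sphere_seminorm_leI)
  fix H ip \<pi> x
  assume "sphere_representation seq_scale H ip q \<pi>" and x: "x \<in> H" "vec_norm ip x \<le> 1"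
  then interpret sphere_representation seq_scale H ip q \<pi> by simp
  define y where "y = \<pi> (free_star a) x"
  have y: "y \<in> H" using x by (simp add: y_def rep_closed)
  have "complex_of_real ((vec_norm ip y)\<^sup>2) = ip (\<pi> a y) x"
    using rep_star[OF y x(1), of a] ip_self[OF y] by (simp add: y_def)
  hence "(vec_norm ip y)\<^sup>2 = cmod (ip (\<pi> a y) x)"
    by (metis abs_power2 norm_of_real)
  also have "\<dots> \<le> vec_norm ip (\<pi> a y) * vec_norm ip x"
    using x y by (intro cauchy_schwarz) (auto simp: rep_closed)
  also have "\<dots> \<le> vec_norm ip (\<pi> a y)"
    using x vec_norm_ge0[OF rep_closed[OF y]] by (simp add: mult_left_le)
  also have "\<dots> \<le> sphere_seminorm q a * vec_norm ip y"
    by (rule rep_norm_le[OF y])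
  finally have "vec_norm ip y * vec_norm ip y \<le> sphere_seminorm q a * vec_norm ip y"
    by (simp add: power2_eq_square)
  thus "vec_norm ip (\<pi> (free_star a) x) \<le> sphere_seminorm q a"
    using vec_norm_ge0[OF y] sphere_seminorm_nonneg[of q a]
    unfolding y_def[symmetric] by (metis mult_right_le_imp_le order_le_less)
qed

lemma sphere_seminorm_relation:
  assumes "(a, b) \<in> sphere_relations q"
  shows "sphere_seminorm q (a - b) = 0"
proof (rule antisym[OF sphere_seminorm_leI sphere_seminorm_nonneg])
  fix H ip \<pi> x
  assume "sphere_representation seq_scale H ip q \<pi>" and x: "x \<in> H"
  then interpret sphere_representation seq_scale H ip q \<pi> by simp
  show "vec_norm ip (\<pi> (a - b) x) \<le> 0" using relation[OF assms x] x by (simp add: rep_diff)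
qed


section \<open>Seminormed rings with scaling and involution\<close>

text \<open>Besides additivity, the axioms say that every operation is continuous for the seminorm.
  Continuity is what lets an operation descend to classes modulo the null ideal and act termwise on
  Cauchy sequences. Algebraic identities such as \<open>(x y)\<^sup>* = y\<^sup>* x\<^sup>*\<close> are instead transported from
  the free algebra by a *-homomorphism.\<close>

locale seminormed_star_ring = ring A for A :: "'a normed_star_algebra" (structure) +
  assumes nrm_zero: "nrm A \<zero> = 0"
    and nrm_minus: "x \<in> carrier A \<Longrightarrow> nrm A (\<ominus> x) \<le> nrm A x"
    and nrm_add: "\<lbrakk>x \<in> carrier A; y \<in> carrier A\<rbrakk> \<Longrightarrow> nrm A (x \<oplus> y) \<le> nrm A x + nrm A y"
    and nrm_mult: "\<lbrakk>x \<in> carrier A; y \<in> carrier A\<rbrakk> \<Longrightarrow> nrm A (x \<otimes> y) \<le> nrm A x * nrm A y"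
    and smult_closed [simp]: "x \<in> carrier A \<Longrightarrow> c \<odot> x \<in> carrier A"
    and smult_add: "\<lbrakk>x \<in> carrier A; y \<in> carrier A\<rbrakk> \<Longrightarrow> c \<odot> (x \<oplus> y) = c \<odot> x \<oplus> c \<odot> y"
    and nrm_smult: "x \<in> carrier A \<Longrightarrow> nrm A (c \<odot> x) \<le> cmod c * nrm A x"
    and star_closed [simp]: "x \<in> carrier A \<Longrightarrow> star A x \<in> carrier A"
    and star_add: "\<lbrakk>x \<in> carrier A; y \<in> carrier A\<rbrakk> \<Longrightarrow> star A (x \<oplus> y) = star A x \<oplus> star A y"
    and nrm_star: "x \<in> carrier A \<Longrightarrow> nrm A (star A x) \<le> nrm A x"

definition star_hom ::
  "('a, 'm) star_algebra_scheme \<Rightarrow> ('b, 'n) star_algebra_scheme \<Rightarrow> ('a \<Rightarrow> 'b) set" where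
  "star_hom A B = {h \<in> Ring.ring_hom A B.
     (\<forall>c. \<forall>x\<in>carrier A. h (c \<odot>\<^bsub>A\<^esub> x) = c \<odot>\<^bsub>B\<^esub> h x) \<and>
     (\<forall>x\<in>carrier A. h (star A x) = star B (h x))}"

lemma star_hom_comp:
  assumes "g \<in> star_hom A B" "h \<in> star_hom B C"
  shows "(\<lambda>x. h (g x)) \<in> star_hom A C"
  using assms by (simp add: star_hom_def Ring.ring_hom_def Pi_iff)

context seminormed_star_ring
begin

lemma nrm_minus_eq: "x \<in> carrier A \<Longrightarrow> nrm A (\<ominus> x) = nrm A x"
  using nrm_minus[of x] nrm_minus[of "\<ominus> x"] by simp

lemma nrm_nonneg: "x \<in> carrier A \<Longrightarrow> 0 \<le> nrm A x"
  using nrm_add[of x "\<ominus> x"] by (simp add: nrm_zero nrm_minus_eq r_neg)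

lemma nrm_abs_diff:
  assumes "x \<in> carrier A" "y \<in> carrier A"
  shows "\<bar>nrm A x - nrm A y\<bar> \<le> nrm A (x \<ominus> y)"
proof -
  have "x = (x \<ominus> y) \<oplus> y" "y = \<ominus> (x \<ominus> y) \<oplus> x"
    using assms by algebra+
  hence "nrm A x \<le> nrm A (x \<ominus> y) + nrm A y" "nrm A y \<le> nrm A (x \<ominus> y) + nrm A x"
    using nrm_add[of "x \<ominus> y" y] nrm_add[of "\<ominus> (x \<ominus> y)" x] assms
    by (simp_all add: nrm_minus_eq)
  thus ?thesis by linarith
qed

lemma additive_diff:
  assumes closed: "\<And>x. x \<in> carrier A \<Longrightarrow> f x \<in> carrier A"
    and add: "\<And>x y. \<lbrakk>x \<in> carrier A; y \<in> carrier A\<rbrakk> \<Longrightarrow> f (x \<oplus> y) = f x \<oplus> f y"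
    and x: "x \<in> carrier A" and y: "y \<in> carrier A"
  shows "f (x \<ominus> y) = f x \<ominus> f y"
proof -
  have "(x \<ominus> y) \<oplus> y = x" using x y by algebra
  hence "f (x \<ominus> y) \<oplus> f y = f x" using add[of "x \<ominus> y" y] x y by simp
  moreover have "f (x \<ominus> y) = (f (x \<ominus> y) \<oplus> f y) \<ominus> f y"
    using closed[of "x \<ominus> y"] closed[OF y] x y by algebra
  ultimately show ?thesis by simp
qed

lemmas smult_diff = additive_diff[OF smult_closed smult_add]
  and star_diff = additive_diff[OF star_closed star_add]

lemma null_idealI: "x \<in> carrier A \<Longrightarrow> nrm A x \<le> 0 \<Longrightarrow> x \<in> null_ideal A"
  using nrm_nonneg[of x] by (simp add: null_ideal_def)

lemma ideal_null_ideal: "ideal (null_ideal A) A"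
proof (rule idealI[OF ring_axioms])
  show "subgroup (null_ideal A) (add_monoid A)"
  proof (rule add.subgroupI)
    show "null_ideal A \<noteq> {}" using nrm_zero by (auto simp: null_ideal_def)
    show "\<ominus> a \<in> null_ideal A" if "a \<in> null_ideal A" for a
      using that by (simp add: null_ideal_def nrm_minus_eq)
    show "a \<oplus> b \<in> null_ideal A" if "a \<in> null_ideal A" "b \<in> null_ideal A" for a b
      using that nrm_add[of a b] by (intro null_idealI) (auto simp: null_ideal_def)
  qed (auto simp: null_ideal_def)
  fix a x assume "a \<in> null_ideal A" "x \<in> carrier A"
  thus "x \<otimes> a \<in> null_ideal A" "a \<otimes> x \<in> null_ideal A"
    using nrm_mult[of x a] nrm_mult[of a x]
    by (intro null_idealI; simp add: null_ideal_def)+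
qed

lemma coset_self: "x \<in> carrier A \<Longrightarrow> x \<in> null_ideal A +> x"
  by (rule abelian_subgroup.a_rcos_self
      [OF abelian_subgroupI3[OF ideal.axioms(1)[OF ideal_null_ideal] is_abelian_group]])

lemma coset_eq_iff:
  "\<lbrakk>x \<in> carrier A; y \<in> carrier A\<rbrakk> \<Longrightarrow>
     null_ideal A +> x = null_ideal A +> y \<longleftrightarrow> nrm A (x \<ominus> y) = 0"
  using quotient_eq_iff_same_a_r_cos[OF ideal_null_ideal, of x y] by (simp add: null_ideal_def)

lemma coset_memD:
  assumes x: "x \<in> carrier A" and y: "y \<in> null_ideal A +> x"
  shows "y \<in> carrier A" "nrm A (y \<ominus> x) = 0"
proof -
  obtain i where i: "i \<in> null_ideal A" "y = i \<oplus> x"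
    using y unfolding a_r_coset_def' by blast
  show "y \<in> carrier A" using i x by (simp add: null_ideal_def)
  have "y \<ominus> x = i" using i x by (simp add: null_ideal_def minus_eq a_assoc r_neg)
  thus "nrm A (y \<ominus> x) = 0" using i by (simp add: null_ideal_def)
qed

text \<open>The operations of the quotient are unions over all representatives of a coset. Such a union
  collapses to a single coset when the operation preserves distance zero.\<close>

lemma coset_UN_eq:
  assumes x: "x \<in> carrier A"
    and f: "\<And>y. y \<in> carrier A \<Longrightarrow> f y \<in> carrier A"
    and null: "\<And>y. y \<in> carrier A \<Longrightarrow> nrm A (y \<ominus> x) = 0 \<Longrightarrow> nrm A (f y \<ominus> f x) = 0"
  shows "(\<Union>y\<in>null_ideal A +> x. null_ideal A +> f y) = null_ideal A +> f x"
proof -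
  have "null_ideal A +> f y = null_ideal A +> f x" if "y \<in> null_ideal A +> x" for y
    using coset_memD[OF x that] f x null by (simp add: coset_eq_iff)
  thus ?thesis using coset_self[OF x] by blast
qed

lemma quotient_nrm:
  assumes x: "x \<in> carrier A"
  shows "nrm (separated_quotient A) (null_ideal A +> x) = nrm A x"
proof -
  have "nrm A y = nrm A x" if "y \<in> null_ideal A +> x" for y
    using coset_memD[OF x that] nrm_abs_diff[of y x] x by simp
  hence "nrm A ` (null_ideal A +> x) = {nrm A x}"
    using coset_self[OF x] by blast
  thus ?thesis by (simp add: separated_quotient_def Let_def)
qed

lemma quotient_carrier: "carrier (separated_quotient A) = (\<lambda>x. null_ideal A +> x) ` carrier A"
  by (auto simp: separated_quotient_def Let_def FactRing_def A_RCOSETS_def')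

lemma quotient_star_hom: "(\<lambda>x. null_ideal A +> x) \<in> star_hom A (separated_quotient A)"
proof -
  have "(\<lambda>x. null_ideal A +> x) \<in> Ring.ring_hom A (separated_quotient A)"
    using ideal.rcos_ring_hom[OF ideal_null_ideal]
    by (simp add: Ring.ring_hom_def separated_quotient_def Let_def)
  moreover have "(\<Union>y\<in>null_ideal A +> x. null_ideal A +> (c \<odot> y)) = null_ideal A +> (c \<odot> x)"
    if "x \<in> carrier A" for c x
  proof (rule coset_UN_eq[OF that])
    fix y assume "y \<in> carrier A" "nrm A (y \<ominus> x) = 0"
    thus "nrm A (c \<odot> y \<ominus> c \<odot> x) = 0"
      using nrm_smult[of "y \<ominus> x" c] nrm_nonneg[of "c \<odot> (y \<ominus> x)"] that
      by (simp add: smult_diff)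
  qed simp
  moreover have "(\<Union>y\<in>null_ideal A +> x. null_ideal A +> star A y) = null_ideal A +> star A x"
    if "x \<in> carrier A" for x
  proof (rule coset_UN_eq[OF that])
    fix y assume "y \<in> carrier A" "nrm A (y \<ominus> x) = 0"
    thus "nrm A (star A y \<ominus> star A x) = 0"
      using nrm_star[of "y \<ominus> x"] nrm_nonneg[of "star A (y \<ominus> x)"] that
      by (simp add: star_diff)
  qed simp
  ultimately show ?thesis
    by (simp add: star_hom_def separated_quotient_def Let_def)
qed

lemma ring_separated_quotient: "ring (separated_quotient A)"
proof -
  interpret Q: ring "A Quot null_ideal A" by (rule ideal.quotient_is_ring[OF ideal_null_ideal])
  have eqs: "carrier (separated_quotient A) = carrier (A Quot null_ideal A)"
    "add (separated_quotient A) = add (A Quot null_ideal A)"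
    "zero (separated_quotient A) = zero (A Quot null_ideal A)"
    "one (separated_quotient A) = one (A Quot null_ideal A)"
    "monoid.mult (separated_quotient A) = monoid.mult (A Quot null_ideal A)"
    by (simp_all add: separated_quotient_def Let_def)
  show ?thesis
  proof (rule ringI)
    show "abelian_group (separated_quotient A)"
      by (rule abelian_groupI)
        (simp_all add: eqs Q.a_ac Q.add.l_inv_ex)
    show "Group.monoid (separated_quotient A)"
      by (rule monoidI) (auto simp: eqs Q.m_assoc)
  qed (auto simp: eqs Q.l_distr Q.r_distr)
qed

end

text \<open>Every axiom is an estimate or an identity between images, so it is inherited from \<open>A\<close>. This
  avoids calculations with cosets when the quotient is again to be completed.\<close>

lemma seminormed_star_ring_image:
  assumes "seminormed_star_ring A" and h: "h \<in> star_hom A B"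
    and "ring B" and surj: "carrier B = h ` carrier A"
    and nrm: "\<And>x. x \<in> carrier A \<Longrightarrow> nrm B (h x) = nrm A x"
  shows "seminormed_star_ring B"
proof -
  interpret A: seminormed_star_ring A by fact
  interpret B: ring B by fact
  interpret h: ring_hom_ring A B h
    using h by (intro ring_hom_ringI2 A.ring_axioms B.ring_axioms) (simp add: star_hom_def)
  have smult: "c \<odot>\<^bsub>B\<^esub> h x = h (c \<odot>\<^bsub>A\<^esub> x)" and star: "star B (h x) = h (star A x)"
    if "x \<in> carrier A" for c x
    using h that by (simp_all add: star_hom_def)
  have rep: thesis if "y \<in> carrier B" "\<And>x. x \<in> carrier A \<Longrightarrow> y = h x \<Longrightarrow> thesis" for y thesis
    using that surj by auto
  note hs = h.hom_add[symmetric] h.hom_mult[symmetric] h.hom_a_inv[symmetric] smult star nrm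
  show ?thesis
  proof
    show "nrm B \<zero>\<^bsub>B\<^esub> = 0" using nrm[of "\<zero>\<^bsub>A\<^esub>"] A.nrm_zero by simp
  next
    fix y assume "y \<in> carrier B"
    then obtain x where x: "x \<in> carrier A" "y = h x" by (rule rep)
    show "nrm B (\<ominus>\<^bsub>B\<^esub> y) \<le> nrm B y" using x A.nrm_minus[of x] by (simp add: hs del: h.hom_a_inv)
    show "star B y \<in> carrier B" using x by (simp add: star)
    show "nrm B (star B y) \<le> nrm B y" using x A.nrm_star[of x] by (simp add: star nrm)
    fix c
    show "c \<odot>\<^bsub>B\<^esub> y \<in> carrier B" using x by (simp add: smult)
    show "nrm B (c \<odot>\<^bsub>B\<^esub> y) \<le> cmod c * nrm B y" using x A.nrm_smult[of x c] by (simp add: smult nrm)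
  next
    fix y y' assume "y \<in> carrier B" "y' \<in> carrier B"
    then obtain x x' where x: "x \<in> carrier A" "x' \<in> carrier A" "y = h x" "y' = h x'"
      by (metis rep)
    show "nrm B (y \<oplus>\<^bsub>B\<^esub> y') \<le> nrm B y + nrm B y'"
      using x A.nrm_add[of x x'] by (simp add: hs del: h.hom_add)
    show "nrm B (y \<otimes>\<^bsub>B\<^esub> y') \<le> nrm B y * nrm B y'"
      using x A.nrm_mult[of x x'] by (simp add: hs del: h.hom_mult)
    show "star B (y \<oplus>\<^bsub>B\<^esub> y') = star B y \<oplus>\<^bsub>B\<^esub> star B y'"
      using x A.star_add[of x x'] by (simp add: hs del: h.hom_add)
    show "c \<odot>\<^bsub>B\<^esub> (y \<oplus>\<^bsub>B\<^esub> y') = c \<odot>\<^bsub>B\<^esub> y \<oplus>\<^bsub>B\<^esub> c \<odot>\<^bsub>B\<^esub> y'" for c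
      using x A.smult_add[of x x' c] by (simp add: hs del: h.hom_add)
  qed
qed

lemma (in seminormed_star_ring) seminormed_separated_quotient:
  "seminormed_star_ring (separated_quotient A)"
  using seminormed_star_ring_axioms quotient_star_hom ring_separated_quotient quotient_carrier
  by (rule seminormed_star_ring_image) (rule quotient_nrm)


section \<open>Cauchy sequences and completion\<close>

context seminormed_star_ring
begin

abbreviation "C \<equiv> cauchy_algebra A"

lemma C_simps:
  "s \<oplus>\<^bsub>C\<^esub> t = (\<lambda>n. s n \<oplus> t n)" "s \<otimes>\<^bsub>C\<^esub> t = (\<lambda>n. s n \<otimes> t n)"
  "\<zero>\<^bsub>C\<^esub> = (\<lambda>n. \<zero>)" "\<one>\<^bsub>C\<^esub> = (\<lambda>n. \<one>)" "c \<odot>\<^bsub>C\<^esub> s = (\<lambda>n. c \<odot> s n)"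
  "star C s = (\<lambda>n. star A (s n))" "nrm C s = lim (\<lambda>n. nrm A (s n))"
  by (simp_all add: cauchy_algebra_def)

lemma C_memD: "s \<in> carrier C \<Longrightarrow> s n \<in> carrier A"
  by (simp add: cauchy_algebra_def)

lemma C_memI:
  assumes "\<And>n. s n \<in> carrier A"
    and "\<And>e. e > 0 \<Longrightarrow> \<exists>N. \<forall>m\<ge>N. \<forall>n\<ge>N. nrm A (s m \<ominus> s n) < e"
  shows "s \<in> carrier C"
  using assms by (simp add: cauchy_algebra_def)

lemma C_cauchy: "s \<in> carrier C \<Longrightarrow> e > 0 \<Longrightarrow> \<exists>N. \<forall>m\<ge>N. \<forall>n\<ge>N. nrm A (s m \<ominus> s n) < e"
  by (simp add: cauchy_algebra_def)

lemma C_const: "x \<in> carrier A \<Longrightarrow> (\<lambda>n. x) \<in> carrier C"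
  by (rule C_memI) (simp_all add: minus_eq r_neg nrm_zero)

text \<open>A Lipschitz estimate on the differences keeps a termwise operation inside the Cauchy
  sequences. For the product the constant comes from the boundedness of the two factors, so two
  given sequences share one constant although multiplication itself is not Lipschitz.\<close>

lemma C_lipschitz:
  assumes s: "s \<in> carrier C" and t: "t \<in> carrier C" and u: "\<And>n. u n \<in> carrier A"
    and K: "K \<ge> 0"
    and le: "\<And>m n. nrm A (u m \<ominus> u n) \<le> K * (nrm A (s m \<ominus> s n) + nrm A (t m \<ominus> t n))"
  shows "u \<in> carrier C"
proof (rule C_memI[OF u])
  fix e :: real assume e: "e > 0"
  \<comment> \<open>\<open>K + 1\<close> instead of \<open>K\<close>, so that \<open>K = 0\<close> causes no division by zero.\<close>
  define d where "d = e / (2 * (K + 1))"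
  have d: "d > 0" using e K by (simp add: d_def)
  have "2 * (K + 1) > 0" using K by simp
  hence de: "2 * (K + 1) * d = e" unfolding d_def by simp
  obtain M where M: "\<And>m n. m \<ge> M \<Longrightarrow> n \<ge> M \<Longrightarrow> nrm A (s m \<ominus> s n) < d"
    using C_cauchy[OF s d] by blast
  obtain N where N: "\<And>m n. m \<ge> N \<Longrightarrow> n \<ge> N \<Longrightarrow> nrm A (t m \<ominus> t n) < d"
    using C_cauchy[OF t d] by blast
  have "nrm A (u m \<ominus> u n) < e" if "m \<ge> max M N" "n \<ge> max M N" for m n
  proof -
    have "nrm A (u m \<ominus> u n) \<le> K * (d + d)"
      using M[of m n] N[of m n] that K
      by (intro order_trans[OF le] mult_left_mono) auto
    also have "\<dots> < (K + 1) * (d + d)" using d by simp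
    also have "\<dots> = e" using de by (simp add: algebra_simps)
    finally show ?thesis .
  qed
  thus "\<exists>N. \<forall>m\<ge>N. \<forall>n\<ge>N. nrm A (u m \<ominus> u n) < e" by blast
qed

lemma C_nrm_tendsto:
  assumes "s \<in> carrier C"
  shows "(\<lambda>n. nrm A (s n)) \<longlonglongrightarrow> nrm C s"
proof -
  have "Cauchy (\<lambda>n. nrm A (s n))"
  proof (rule CauchyI)
    fix e :: real assume "e > 0"
    then obtain N where N: "nrm A (s m \<ominus> s n) < e" if "m \<ge> N" "n \<ge> N" for m n
      using C_cauchy[OF assms] by blast
    have "norm (nrm A (s m) - nrm A (s n)) < e" if "m \<ge> N" "n \<ge> N" for m n
      using nrm_abs_diff[OF C_memD[OF assms] C_memD[OF assms], of m n] N[OF that] by simp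
    thus "\<exists>N. \<forall>m\<ge>N. \<forall>n\<ge>N. norm (nrm A (s m) - nrm A (s n)) < e" by blast
  qed
  thus ?thesis
    using Cauchy_convergent_iff convergent_LIMSEQ_iff by (auto simp: C_simps)
qed

lemma C_bounded:
  assumes "s \<in> carrier C"
  obtains K where "K \<ge> 0" "\<And>n. nrm A (s n) \<le> K"
proof -
  have "Bseq (\<lambda>n. nrm A (s n))"
    using C_nrm_tendsto[OF assms] by (auto intro: convergent_imp_Bseq convergentI)
  then obtain K where "K > 0" "\<And>n. norm (nrm A (s n)) \<le> K"
    by (auto elim: BseqE)
  thus thesis using that[of K] by (auto simp: abs_le_iff)
qed

lemma C_add_closed:
  assumes s: "s \<in> carrier C" and t: "t \<in> carrier C"
  shows "(\<lambda>n. s n \<oplus> t n) \<in> carrier C"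
proof (rule C_lipschitz[OF s t, of _ 1])
  fix m n
  note c = C_memD[OF s] C_memD[OF t]
  have "(s m \<oplus> t m) \<ominus> (s n \<oplus> t n) = (s m \<ominus> s n) \<oplus> (t m \<ominus> t n)"
    using c[of m] c[of n] by algebra
  thus "nrm A ((s m \<oplus> t m) \<ominus> (s n \<oplus> t n)) \<le> 1 * (nrm A (s m \<ominus> s n) + nrm A (t m \<ominus> t n))"
    using nrm_add[of "s m \<ominus> s n" "t m \<ominus> t n"] c by simp
qed (simp_all add: C_memD[OF s] C_memD[OF t])

lemma C_mult_closed:
  assumes s: "s \<in> carrier C" and t: "t \<in> carrier C"
  shows "(\<lambda>n. s n \<otimes> t n) \<in> carrier C"
proof -
  note c = C_memD[OF s] C_memD[OF t]
  obtain K where K: "K \<ge> 0" "\<And>n. nrm A (s n) \<le> K" using C_bounded[OF s] by blast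
  obtain L where L: "L \<ge> 0" "\<And>n. nrm A (t n) \<le> L" using C_bounded[OF t] by blast
  show ?thesis
  proof (rule C_lipschitz[OF s t, of _ "K + L"])
    fix m n
    have "(s m \<otimes> t m) \<ominus> (s n \<otimes> t n) = (s m \<ominus> s n) \<otimes> t m \<oplus> s n \<otimes> (t m \<ominus> t n)"
      using c[of m] c[of n] by algebra
    hence "nrm A ((s m \<otimes> t m) \<ominus> (s n \<otimes> t n))
        \<le> nrm A ((s m \<ominus> s n) \<otimes> t m) + nrm A (s n \<otimes> (t m \<ominus> t n))"
      using nrm_add[of "(s m \<ominus> s n) \<otimes> t m" "s n \<otimes> (t m \<ominus> t n)"] c by simp
    also have "\<dots> \<le> nrm A (s m \<ominus> s n) * nrm A (t m) + nrm A (s n) * nrm A (t m \<ominus> t n)"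
      using nrm_mult[of "s m \<ominus> s n" "t m"] nrm_mult[of "s n" "t m \<ominus> t n"] c by simp
    also have "\<dots> \<le> nrm A (s m \<ominus> s n) * L + K * nrm A (t m \<ominus> t n)"
      using K(2)[of n] L(2)[of m] nrm_nonneg[of "s m \<ominus> s n"] nrm_nonneg[of "t m \<ominus> t n"] c
      by (intro add_mono mult_left_mono mult_right_mono) auto
    also have "\<dots> \<le> (K + L) * (nrm A (s m \<ominus> s n) + nrm A (t m \<ominus> t n))"
      using K(1) L(1) nrm_nonneg[of "s m \<ominus> s n"] nrm_nonneg[of "t m \<ominus> t n"] c
      by (simp add: algebra_simps)
    finally show "nrm A ((s m \<otimes> t m) \<ominus> (s n \<otimes> t n))
        \<le> (K + L) * (nrm A (s m \<ominus> s n) + nrm A (t m \<ominus> t n))" .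
  qed (use c K L in auto)
qed

lemma C_map_closed:
  assumes s: "s \<in> carrier C" and K: "K \<ge> 0"
    and f: "\<And>x. x \<in> carrier A \<Longrightarrow> f x \<in> carrier A"
    and diff: "\<And>x y. \<lbrakk>x \<in> carrier A; y \<in> carrier A\<rbrakk> \<Longrightarrow> f (x \<ominus> y) = f x \<ominus> f y"
    and le: "\<And>x. x \<in> carrier A \<Longrightarrow> nrm A (f x) \<le> K * nrm A x"
  shows "(\<lambda>n. f (s n)) \<in> carrier C"
proof (rule C_lipschitz[OF s s _ K])
  fix m n
  have "nrm A (f (s m) \<ominus> f (s n)) \<le> K * nrm A (s m \<ominus> s n)"
    using le[of "s m \<ominus> s n"] C_memD[OF s] by (simp add: diff)
  also have "\<dots> \<le> K * (nrm A (s m \<ominus> s n) + nrm A (s m \<ominus> s n))"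
    using K nrm_nonneg[of "s m \<ominus> s n"] C_memD[OF s] by (intro mult_left_mono) auto
  finally show "nrm A (f (s m) \<ominus> f (s n)) \<le> K * (nrm A (s m \<ominus> s n) + nrm A (s m \<ominus> s n))" .
qed (simp add: f C_memD[OF s])

lemma C_minus_closed: "s \<in> carrier C \<Longrightarrow> (\<lambda>n. \<ominus> s n) \<in> carrier C"
  by (rule C_map_closed[of _ 1]) (auto simp: minus_eq minus_add nrm_minus)

lemma C_smult_closed: "s \<in> carrier C \<Longrightarrow> (\<lambda>n. c \<odot> s n) \<in> carrier C"
  by (rule C_map_closed[of _ "cmod c"]) (auto simp: smult_diff nrm_smult)

lemma C_star_closed: "s \<in> carrier C \<Longrightarrow> (\<lambda>n. star A (s n)) \<in> carrier C"
  by (rule C_map_closed[of _ 1]) (auto simp: star_diff nrm_star)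

lemma ring_cauchy_algebra: "ring C"
proof (rule ringI)
  show "abelian_group C"
  proof (rule abelian_groupI)
    fix s assume s: "s \<in> carrier C"
    show "\<exists>t\<in>carrier C. t \<oplus>\<^bsub>C\<^esub> s = \<zero>\<^bsub>C\<^esub>"
      using s by (intro bexI[OF _ C_minus_closed]) (simp_all add: C_simps C_memD l_neg)
  qed (auto simp: C_simps C_memD C_const fun_eq_iff a_ac intro: C_add_closed)
  show "Group.monoid C"
    by (rule monoidI) (auto simp: C_simps C_memD C_const fun_eq_iff m_assoc intro: C_mult_closed)
qed (auto simp: C_simps C_memD fun_eq_iff l_distr r_distr)

lemma C_a_inv: "s \<in> carrier C \<Longrightarrow> \<ominus>\<^bsub>C\<^esub> s = (\<lambda>n. \<ominus> s n)"
proof -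
  assume s: "s \<in> carrier C"
  interpret C: ring C by (rule ring_cauchy_algebra)
  show ?thesis
    using s by (intro C.minus_equality C_minus_closed) (simp_all add: C_simps C_memD l_neg)
qed

lemma seminormed_cauchy_algebra: "seminormed_star_ring C"
proof -
  interpret C: ring C by (rule ring_cauchy_algebra)
  note L = C_nrm_tendsto
  show ?thesis
  proof
    show "nrm C \<zero>\<^bsub>C\<^esub> = 0" by (simp add: C_simps nrm_zero)
  next
    fix s assume s: "s \<in> carrier C"
    note c = C_memD[OF s]
    show "nrm C (\<ominus>\<^bsub>C\<^esub> s) \<le> nrm C s"
      using L[OF C_minus_closed[OF s]] c unfolding C_a_inv[OF s]
      by (intro LIMSEQ_le[OF _ L[OF s]]) (auto simp: nrm_minus)
    show "star C s \<in> carrier C" using C_star_closed[OF s] by (simp add: C_simps)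
    show "nrm C (star C s) \<le> nrm C s"
      using L[OF C_star_closed[OF s]] c unfolding C_simps(6)
      by (intro LIMSEQ_le[OF _ L[OF s]]) (auto simp: nrm_star)
    fix a
    show "a \<odot>\<^bsub>C\<^esub> s \<in> carrier C" using C_smult_closed[OF s] by (simp add: C_simps)
    show "nrm C (a \<odot>\<^bsub>C\<^esub> s) \<le> cmod a * nrm C s"
      using L[OF C_smult_closed[OF s, of a]] c unfolding C_simps(5)
      by (intro LIMSEQ_le[OF _ tendsto_mult_left[OF L[OF s]]]) (auto simp: nrm_smult)
  next
    fix s t assume s: "s \<in> carrier C" and t: "t \<in> carrier C"
    note c = C_memD[OF s] C_memD[OF t]
    show "nrm C (s \<oplus>\<^bsub>C\<^esub> t) \<le> nrm C s + nrm C t"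
      using L[OF C_add_closed[OF s t]] c unfolding C_simps(1)
      by (intro LIMSEQ_le[OF _ tendsto_add[OF L[OF s] L[OF t]]]) (auto simp: nrm_add)
    show "nrm C (s \<otimes>\<^bsub>C\<^esub> t) \<le> nrm C s * nrm C t"
      using L[OF C_mult_closed[OF s t]] c unfolding C_simps(2)
      by (intro LIMSEQ_le[OF _ tendsto_mult[OF L[OF s] L[OF t]]]) (auto simp: nrm_mult)
    show "star C (s \<oplus>\<^bsub>C\<^esub> t) = star C s \<oplus>\<^bsub>C\<^esub> star C t"
      using c by (simp add: C_simps star_add)
    show "a \<odot>\<^bsub>C\<^esub> (s \<oplus>\<^bsub>C\<^esub> t) = a \<odot>\<^bsub>C\<^esub> s \<oplus>\<^bsub>C\<^esub> a \<odot>\<^bsub>C\<^esub> t" for a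
      using c by (simp add: C_simps smult_add)
  qed
qed

lemma const_star_hom: "(\<lambda>x n. x) \<in> star_hom A C"
  by (auto simp: star_hom_def Ring.ring_hom_def C_simps C_const)

lemma seminormed_completion: "seminormed_star_ring (completion A)"
  unfolding completion_def
  by (intro seminormed_star_ring.seminormed_separated_quotient seminormed_cauchy_algebra)

lemma completion_embedding_star_hom: "completion_embedding A \<in> star_hom A (completion A)"
  using star_hom_comp[OF const_star_hom
      seminormed_star_ring.quotient_star_hom[OF seminormed_cauchy_algebra]]
  unfolding completion_def completion_embedding_def .

end


section \<open>The free algebra inside the algebra of the sphere\<close>

lemma ring_free_sphere_algebra: "ring (free_sphere_algebra q)"
proof (rule ringI)
  show "abelian_group (free_sphere_algebra q)"
    by (rule abelian_groupI)
      (auto simp: free_sphere_algebra_def add_ac intro: exI[of _ "- x" for x])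
  show "Group.monoid (free_sphere_algebra q)"
    by (rule monoidI) (auto simp: free_sphere_algebra_def mult.assoc)
qed (auto simp: free_sphere_algebra_def algebra_simps)

lemma free_sphere_algebra_a_inv: "\<ominus>\<^bsub>free_sphere_algebra q\<^esub> a = - a"
proof -
  interpret ring "free_sphere_algebra q" by (rule ring_free_sphere_algebra)
  show ?thesis by (rule minus_equality) (auto simp: free_sphere_algebra_def)
qed

lemma free_sphere_algebra_minus: "a \<ominus>\<^bsub>free_sphere_algebra q\<^esub> b = a - b"
  by (simp add: a_minus_def free_sphere_algebra_a_inv) (simp add: free_sphere_algebra_def)

lemma seminormed_free_sphere_algebra: "seminormed_star_ring (free_sphere_algebra q)"
proof -
  interpret ring "free_sphere_algebra q" by (rule ring_free_sphere_algebra)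
  have minus: "sphere_seminorm q (- a) \<le> sphere_seminorm q a" for a
    using sphere_seminorm_scale[of q "-1" a] by (simp add: free_scale_minus_scalar free_scale_one)
  show ?thesis
  proof
    show "nrm (free_sphere_algebra q) (\<ominus>\<^bsub>free_sphere_algebra q\<^esub> a) \<le> nrm (free_sphere_algebra q) a" for a
      using minus by (simp add: free_sphere_algebra_a_inv) (simp add: free_sphere_algebra_def)
  qed (simp_all add: free_sphere_algebra_def sphere_seminorm_zero sphere_seminorm_add
      sphere_seminorm_mult sphere_seminorm_scale sphere_seminorm_star free_scale_add free_star_add)
qed

text \<open>The canonical *-homomorphism from the free algebra to the completed quotient; its values on
  the free generators are \<open>sphere_gen\<close>.\<close>

definition sphere_class :: "real \<Rightarrow> free_alg \<Rightarrow> (nat \<Rightarrow> free_alg set) set" where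
  "sphere_class q a = completion_embedding (separated_quotient (free_sphere_algebra q))
     (null_ideal (free_sphere_algebra q) +>\<^bsub>free_sphere_algebra q\<^esub> a)"

lemma sphere_class_star_hom: "sphere_class q \<in> star_hom (free_sphere_algebra q) (sphere_algebra q)"
proof -
  interpret F: seminormed_star_ring "free_sphere_algebra q" by (rule seminormed_free_sphere_algebra)
  interpret Q: seminormed_star_ring "separated_quotient (free_sphere_algebra q)"
    by (rule F.seminormed_separated_quotient)
  show ?thesis
    using star_hom_comp[OF F.quotient_star_hom Q.completion_embedding_star_hom]
    unfolding sphere_class_def[abs_def] sphere_algebra_def .
qed

lemma ring_sphere_algebra: "ring (sphere_algebra q)"
  unfolding sphere_algebra_def
  by (intro seminormed_star_ring.axioms(1) seminormed_star_ring.seminormed_completion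
      seminormed_star_ring.seminormed_separated_quotient seminormed_free_sphere_algebra)

lemma sphere_class_relation:
  assumes "(a, b) \<in> sphere_relations q"
  shows "sphere_class q a = sphere_class q b"
proof -
  interpret F: seminormed_star_ring "free_sphere_algebra q" by (rule seminormed_free_sphere_algebra)
  have "nrm (free_sphere_algebra q) (a \<ominus>\<^bsub>free_sphere_algebra q\<^esub> b) = 0"
    unfolding free_sphere_algebra_minus
    using sphere_seminorm_relation[OF assms] by (simp add: free_sphere_algebra_def)
  thus ?thesis
    unfolding sphere_class_def using F.coset_eq_iff[of a b] by (simp add: free_sphere_algebra_def)
qed


section \<open>The projection modulo the defining relations\<close>

text \<open>The matrix \<open>2 e\<close>, lifted to the free algebra. Dropping the factor one half makes the identity
  to be checked \<open>(2 e)\<^sup>2 = 2 (2 e)\<close>, whose only coefficients besides integers are powers of \<open>q\<close>.\<close>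

definition projection_entries :: "real \<Rightarrow> free_alg list list" where
  "projection_entries q =
    (let \<alpha> = free_gen Alpha; \<beta> = free_gen Beta; z = free_gen Zed; q' = complex_of_real q in
     [[1 + z, 0, \<alpha>, \<beta>],
      [0, 1 + z, free_scale (- q') (free_star \<beta>), free_star \<alpha>],
      [free_star \<alpha>, free_scale (- q') \<beta>, 1 - z, 0],
      [free_star \<beta>, \<alpha>, 0, 1 - z]])"

text \<open>Any *-homomorphism that respects the relations makes the matrix a projection. The algebra of
  the sphere enters only through \<open>sphere_class\<close>; all computations take place in the free algebra,
  modulo the kernel \<open>null\<close> of \<open>h\<close>.\<close>

locale sphere_relations_hom = ring B for B :: "('b, 'm) star_algebra_scheme" (structure) +
  fixes q :: real and h :: "free_alg \<Rightarrow> 'b"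
  assumes star_hom: "h \<in> star_hom (free_sphere_algebra q) B"
    and relation: "(a, b) \<in> sphere_relations q \<Longrightarrow> h a = h b"
begin

sublocale h: ring_hom_ring "free_sphere_algebra q" B h
  using star_hom
  by (intro ring_hom_ringI2 ring_free_sphere_algebra ring_axioms) (simp add: star_hom_def)

lemma hom_closed [simp]: "h a \<in> carrier B"
  using h.hom_closed[of a] by (simp add: free_sphere_algebra_def)

lemma hom_add: "h (a + b) = h a \<oplus> h b"
  and hom_mult: "h (a * b) = h a \<otimes> h b"
  and hom_zero: "h 0 = \<zero>"
  and hom_one: "h 1 = \<one>"
  and hom_scale: "h (free_scale c a) = c \<odot> h a"
  and hom_star: "h (free_star a) = star B (h a)"
  using h.hom_add[of a b] h.hom_mult[of a b] h.hom_zero h.hom_one star_hom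
  by (simp_all add: free_sphere_algebra_def star_hom_def)

lemma hom_minus: "h (a - b) = h a \<ominus> h b"
proof -
  have "h (a - b) \<oplus> h b = h a" by (simp flip: hom_add)
  thus ?thesis by (metis hom_closed add.inv_solve_right a_minus_def)
qed

lemma hom_sum: "h (\<Sum>k<n. f k) = (\<Oplus>k\<in>{..<n::nat}. h (f k))"
  by (induction n) (simp_all add: hom_zero hom_add lessThan_Suc a_comm)

definition null :: "free_alg set" where
  "null = {a. h a = \<zero>}"

lemma null_iff: "a - b \<in> null \<longleftrightarrow> h a = h b"
proof
  assume "a - b \<in> null"
  hence "h (a - b) \<oplus> h b = h b" by (simp add: null_def)
  thus "h a = h b" by (simp flip: hom_add)
qed (simp add: null_def hom_minus a_minus_def r_neg)

lemma null_add: "a \<in> null \<Longrightarrow> b \<in> null \<Longrightarrow> a + b \<in> null"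
  and null_diff: "a \<in> null \<Longrightarrow> b \<in> null \<Longrightarrow> a - b \<in> null"
  and null_mult_left: "a \<in> null \<Longrightarrow> c * a \<in> null"
  and null_mult_right: "a \<in> null \<Longrightarrow> a * c \<in> null"
  by (simp_all add: null_def hom_add hom_minus hom_mult a_minus_def)

lemma null_scale: "a \<in> null \<Longrightarrow> free_scale c a \<in> null"
  using hom_scale[of c 0] by (simp add: null_def hom_scale hom_zero free_scale_zero)

lemma null_star: "a \<in> null \<Longrightarrow> free_star a \<in> null"
  using hom_star[of 0] by (simp add: null_def hom_star hom_zero free_star_zero)

lemma null_uminus: "a \<in> null \<Longrightarrow> - a \<in> null"
  using null_diff[of 0 a] by (simp add: null_def hom_zero)

lemmas null_intros = null_add null_diff null_mult_left null_mult_right null_scale null_star null_uminus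

abbreviation "\<alpha> \<equiv> free_gen Alpha"
abbreviation "\<beta> \<equiv> free_gen Beta"
abbreviation "z \<equiv> free_gen Zed"
abbreviation "q' \<equiv> complex_of_real q"

lemma null_relations:
  "\<beta> * \<alpha> - free_scale q' (\<alpha> * \<beta>) \<in> null"
  "free_star \<beta> * \<alpha> - free_scale q' (\<alpha> * free_star \<beta>) \<in> null"
  "\<beta> * free_star \<beta> - free_star \<beta> * \<beta> \<in> null"
  "z - free_star z \<in> null"
  "z * \<alpha> - \<alpha> * z \<in> null"
  "z * \<beta> - \<beta> * z \<in> null"
  "free_star \<alpha> * \<alpha> + free_scale (q'^2) (free_star \<beta> * \<beta>) + z * z - 1 \<in> null"
  "\<alpha> * free_star \<alpha> + \<beta> * free_star \<beta> + z * z - 1 \<in> null"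
  using relation by (simp_all add: null_iff sphere_relations_def Let_def flip: power2_eq_square)

lemmas star_simps = free_star_add free_star_diff free_star_mult free_star_scale free_star_star free_star_one

text \<open>The kernel is closed under \<open>free_star\<close>, so the adjoints of the relations hold as well; the
  two \<open>q\<close>-commutation relations yield the ones needed in the second and third row.\<close>

lemma null_relations_star:
  "free_star \<alpha> * free_star \<beta> - free_scale q' (free_star \<beta> * free_star \<alpha>) \<in> null"
  "free_star \<alpha> * \<beta> - free_scale q' (\<beta> * free_star \<alpha>) \<in> null"
  using null_relations(1,2)[THEN null_star] by (simp_all add: star_simps)

text \<open>The adjoint of \<open>z g - g z\<close> involves \<open>z\<^sup>*\<close> in place of \<open>z\<close>; two corrections by \<open>z - z\<^sup>*\<close>
  compensate for this.\<close>

lemma null_commute_star: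
  assumes "z * g - g * z \<in> null"
  shows "z * free_star g - free_star g * z \<in> null"
proof -
  have "z * free_star g - free_star g * z =
      (z - free_star z) * free_star g - free_star g * (z - free_star z) - free_star (z * g - g * z)"
    by (simp add: star_simps algebra_simps)
  thus ?thesis using assms null_relations(4) by (simp add: null_intros)
qed

abbreviation F where "F i j \<equiv> projection_entries q ! i ! j"

lemma less_4: "(i::nat) < 4 \<longleftrightarrow> i = 0 \<or> i = 1 \<or> i = 2 \<or> i = 3"
  by auto

lemma sum_4: "(\<Sum>k<4. f k) = f 0 + f 1 + f 2 + (f 3 :: free_alg)" for f :: "nat \<Rightarrow> free_alg"
  by (simp add: numeral_eq_Suc)

lemma free_scale_square: "free_scale q' (free_scale q' a) = free_scale (q'^2) a"
  by (simp add: free_scale_scale power2_eq_square)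

text \<open>Each entry of \<open>(2 e)\<^sup>2 - 2 (2 e)\<close> is a combination of the relations and their adjoints:
  the diagonal entries are the two sphere relations, the diagonal blocks contribute
  the \<open>q\<close>-commutation relations of \<open>\<alpha>\<close> and \<open>\<beta>\<close>, and the off-diagonal blocks the centrality of \<open>z\<close>.
  In the last two rows the order of \<open>\<beta>\<close> and \<open>\<beta>\<^sup>*\<close> on the diagonal is reversed, which the normality
  of \<open>\<beta>\<close> corrects.\<close>

lemma entries_square:
  assumes "i < 4" "j < 4"
  shows "(\<Sum>k<4. F i k * F k j) - free_scale 2 (F i j) \<in> null"
proof -
  note [simp] = projection_entries_def Let_def sum_4 free_scale_two free_scale_square
    free_scale_minus_scalar free_scale_mult_left free_scale_mult_right free_scale_add free_scale_diff
    free_scale_zero free_scale_uminus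
  note R = null_relations null_relations_star null_commute_star[OF null_relations(5)]
    null_commute_star[OF null_relations(6)]
  have eq_in_null: "b \<in> null" if "a \<in> null" "b = a" for a b
    using that by simp
  let ?D = "\<lambda>i j. (\<Sum>k<4. F i k * F k j) - free_scale 2 (F i j)"
  have "?D 0 0 \<in> null" by (rule eq_in_null[OF R(8)])
    (simp add: algebra_simps)
  moreover have "?D 0 1 \<in> null" by (rule eq_in_null[OF R(1)])
    (simp add: algebra_simps)
  moreover have "?D 0 2 \<in> null" by (rule eq_in_null[OF R(5)])
    (simp add: algebra_simps)
  moreover have "?D 0 3 \<in> null" by (rule eq_in_null[OF R(6)])
    (simp add: algebra_simps)
  moreover have "?D 1 0 \<in> null" by (rule eq_in_null[OF R(9)])
    (simp add: algebra_simps)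
  moreover have "?D 1 1 \<in> null" by (rule eq_in_null[OF R(7)])
    (simp add: algebra_simps)
  moreover have "?D 1 2 \<in> null" by (rule eq_in_null[OF null_uminus[OF null_scale[OF R(12), of q']]])
    (simp add: algebra_simps)
  moreover have "?D 1 3 \<in> null" by (rule eq_in_null[OF R(11)])
    (simp add: algebra_simps)
  moreover have "?D 2 0 \<in> null" by (rule eq_in_null[OF null_uminus[OF R(11)]])
    (simp add: algebra_simps)
  moreover have "?D 2 1 \<in> null" by (rule eq_in_null[OF null_scale[OF R(6), of q']])
    (simp add: algebra_simps)
  moreover have "?D 2 2 \<in> null" by (rule eq_in_null[OF null_add[OF R(7) null_scale[OF R(3), of "q'^2"]]])
    (simp add: algebra_simps)
  moreover have "?D 2 3 \<in> null" by (rule eq_in_null[OF R(10)])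
    (simp add: algebra_simps)
  moreover have "?D 3 0 \<in> null" by (rule eq_in_null[OF null_uminus[OF R(12)]])
    (simp add: algebra_simps)
  moreover have "?D 3 1 \<in> null" by (rule eq_in_null[OF null_uminus[OF R(5)]])
    (simp add: algebra_simps)
  moreover have "?D 3 2 \<in> null" by (rule eq_in_null[OF R(2)])
    (simp add: algebra_simps)
  moreover have "?D 3 3 \<in> null" by (rule eq_in_null[OF null_diff[OF R(8) R(3)]])
    (simp add: algebra_simps)
  ultimately show ?thesis using assms unfolding less_4 by blast
qed

lemma entries_star:
  assumes "i < 4" "j < 4"
  shows "free_star (F j i) - F i j \<in> null"
proof -
  have "0 \<in> null" by (simp add: null_def hom_zero)
  thus ?thesis
    using assms null_relations(4) null_uminus[OF null_relations(4)] unfolding less_4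
    by (auto simp: projection_entries_def Let_def star_simps free_star_zero)
qed

lemma projection_matrix:
  defines "M \<equiv> mat 4 4 (\<lambda>(i, j). h (free_scale (1/2) (F i j)))"
  shows "M \<in> carrier (matrix_algebra 4 B)"
    and "M \<otimes>\<^bsub>matrix_algebra 4 B\<^esub> M = M"
    and "star (matrix_algebra 4 B) M = M"
proof -
  show "M \<in> carrier (matrix_algebra 4 B)"
    by (auto simp: matrix_algebra_def M_def)
  have "(\<Oplus>k\<in>{..<4}. M $$ (i, k) \<otimes> M $$ (k, j)) = M $$ (i, j)" if ij: "i < 4" "j < 4" for i j
  proof -
    have "(\<Oplus>k\<in>{..<4}. M $$ (i, k) \<otimes> M $$ (k, j)) =
        (\<Oplus>k\<in>{..<4}. h (free_scale (1/2) (F i k) * free_scale (1/2) (F k j)))"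
      by (rule finsum_cong') (use ij in \<open>auto simp: M_def hom_mult\<close>)
    also have "\<dots> = h (\<Sum>k<4. free_scale (1/2) (F i k) * free_scale (1/2) (F k j))"
      by (rule hom_sum[symmetric])
    also have "\<dots> = h (free_scale (1/2) (F i j))"
    proof -
      have "(\<Sum>k<4. free_scale (1/2) (F i k) * free_scale (1/2) (F k j)) - free_scale (1/2) (F i j)
          = free_scale (1/4) ((\<Sum>k<4. F i k * F k j) - free_scale 2 (F i j))"
        by (simp add: sum_4 free_scale_mult_left free_scale_mult_right free_scale_scale
            free_scale_add free_scale_diff)
      also have "\<dots> \<in> null" by (rule null_scale[OF entries_square[OF ij]])
      finally show ?thesis by (simp add: null_iff)
    qed
    finally show ?thesis using ij by (simp add: M_def)
  qed
  thus "M \<otimes>\<^bsub>matrix_algebra 4 B\<^esub> M = M"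
    by (intro eq_matI) (auto simp: matrix_algebra_def M_def)
  have "star B (h (free_scale (1/2) (F j i))) = h (free_scale (1/2) (F i j))" if "i < 4" "j < 4" for i j
  proof -
    have "h (free_star (F j i)) = h (F i j)" using entries_star[OF that] by (simp add: null_iff)
    thus ?thesis unfolding hom_star[symmetric] by (simp add: free_star_scale hom_scale)
  qed
  thus "star (matrix_algebra 4 B) M = M"
    by (intro eq_matI) (auto simp: matrix_algebra_def M_def)
qed

end

theorem mainTheorem1:
  fixes q :: real
  assumes "q \<in> {-1..<0} \<union> {0<..1}"
  shows
    "let A = sphere_algebra q; M4 = matrix_algebra 4 A;
         \<alpha> = sphere_gen q Alpha; \<beta> = sphere_gen q Beta; z = sphere_gen q Zed;
         e = (1/2) \<odot>\<^bsub>M4\<^esub> mat_of_rows_list 4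
           [[\<one>\<^bsub>A\<^esub> \<oplus>\<^bsub>A\<^esub> z, \<zero>\<^bsub>A\<^esub>, \<alpha>, \<beta>],
            [\<zero>\<^bsub>A\<^esub>, \<one>\<^bsub>A\<^esub> \<oplus>\<^bsub>A\<^esub> z, (- complex_of_real q) \<odot>\<^bsub>A\<^esub> star A \<beta>, star A \<alpha>],
            [star A \<alpha>, (- complex_of_real q) \<odot>\<^bsub>A\<^esub> \<beta>, \<one>\<^bsub>A\<^esub> \<ominus>\<^bsub>A\<^esub> z, \<zero>\<^bsub>A\<^esub>],
            [star A \<beta>, \<alpha>, \<zero>\<^bsub>A\<^esub>, \<one>\<^bsub>A\<^esub> \<ominus>\<^bsub>A\<^esub> z]]
     in e \<in> carrier M4 \<and> e \<otimes>\<^bsub>M4\<^esub> e = e \<and> star M4 e = e"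
proof -
  interpret sphere_relations_hom "sphere_algebra q" q "sphere_class q"
    by (intro sphere_relations_hom.intro sphere_relations_hom_axioms.intro
        ring_sphere_algebra sphere_class_star_hom sphere_class_relation)
  have gen: "sphere_gen q g = sphere_class q (free_gen g)" for g
    by (simp add: sphere_gen_def sphere_class_def)
  let ?h = "sphere_class q"
  \<comment> \<open>The given matrix is the image of the lifted one under \<open>sphere_class\<close>.\<close>
  have rows: "(1/2) \<odot>\<^bsub>matrix_algebra 4 (sphere_algebra q)\<^esub>
        mat_of_rows_list 4 (map (map ?h) (projection_entries q))
      = mat 4 4 (\<lambda>(i, j). ?h (free_scale (1/2) (F i j)))"
    by (rule eq_matI)
      (auto simp: matrix_algebra_def mat_of_rows_list_def hom_scale projection_entries_def Let_def less_4)
  show ?thesis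
    using projection_matrix unfolding rows[symmetric]
    by (simp add: projection_entries_def Let_def gen hom_add hom_minus hom_zero hom_one hom_scale hom_star)
qed

end
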